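(* Let $\{\widehat\theta_N\}_{N=1}^\infty\subseteq S$ be a sequence of hyper-parameter estimates, for some compact set $S\subseteq R_\theta$, and let $k(\theta)=k_{\mathrm{Mat}}(\theta)$ be the Matérn kernel. Assume: (a) $U\subseteq\mathbb R^{d_u}$ is compact, with Lipschitz boundary, and satisfies an interior cone condition; (b) the native space $H_{k(\theta)}(U)$ is isomorphic to the Sobolev space $H^{\tau(\theta)}(U)$ (for the Matérn kernel, $\tau(\theta)=\nu+d_u/2$); (c) $f\in H^{\tilde\tau}(U)$ for some $\tilde\tau=n+r$, with $n\in\mathbb N$, $n>d_u/2$ and $0\le r<1$; (d) $m(\theta)\in H^{\tilde\tau}(U)$ for all $\theta\in S$; (e) for some $N^*\in\mathbb N$, the quantities $\tau_-:=\inf_{N\ge N^*}\tau(\widehat\theta_N)$ and $\tau_+:=\sup_{N\ge N^*}\tau(\widehat\theta_N)$ satisfy $\tau_-=n'+r'$, with $n'\in\mathbb N$, $n'>d_u/2$ and $0\le r'<1$. Then there exist a constant $C$, independent of $N$, and a constant $h_0>0$, such that $$\|k_N^{1/2}(\widehat\theta_N)\|_{L^2(U)}\le C\,h_{D_N,U}^{\min\{\tilde\tau,\tau_-\}-d_u/2-\varepsilon}\,\rho_{D_N,U}^{\max\{\tau_+-\tilde\tau,0\}}$$ for any $N\ge N^*$ with $h_{D_N,U}\le h_0$ and any $\varepsilon>0$.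
   Context: Gaussian process regression. $f:U\to\mathbb R$ is a fixed function on $U\subseteq\mathbb R^{d_u}$. Hyper-parameters $\theta=\{\theta_{\mathrm{mean}},\theta_{\mathrm{cov}}\}$ range over $R_\theta\subseteq\mathbb R^{d_\theta}$; $m(\theta;\cdot):U\to\mathbb R$ is a prior mean function (depending on $\theta_{\mathrm{mean}}$) and $k(\theta;\cdot,\cdot):U\times U\to\mathbb R$ a positive-definite covariance kernel (depending on $\theta_{\mathrm{cov}}$). For each $N$, $D_N=\{u^1,\dots,u^N\}\subseteq U$ is a set of $N$ distinct design points. The predictive covariance is $$k_N(\theta;u,u')=k(\theta;u,u')-k(\theta;u,D_N)^TK(\theta;D_N)^{-1}k(\theta;u',D_N),$$ where $k(\theta;u,D_N)=[k(\theta;u,u^1),\dots,k(\theta;u,u^N)]\in\mathbb R^N$ and $K(\theta;D_N)\in\mathbb R^{N\times N}$ has entries $k(\theta;u^i,u^j)$. Notation: $\|k_N^{1/2}(\theta)\|_{L^2(U)}=\big(\int_U k_N(\theta;u,u)\,du\big)^{1/2}$. The estimates $\widehat\theta_N$ are arbitrary (they may depend on the values of $f$ on $D_N$ and need not converge). Matérn kernel: for $\theta_{\mathrm{cov}}=\{\sigma^2,\lambda,\nu\}\in(0,\infty)^3$, $$k_{\mathrm{Mat}}(\theta;u,u')=\frac{\sigma^2}{\Gamma(\nu)2^{\nu-1}}\Big(\frac{\|u-u'\|_2}{\lambda}\Big)^\nu B_\nu\Big(\frac{\|u-u'\|_2}{\lambda}\Big),$$ with $\Gamma$ the Gamma function and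 $B_\nu$ the modified Bessel function of the second kind (value $\sigma^2$ at $u=u'$). Here the $\theta_{\mathrm{cov}}$-components of $R_\theta$ range over $(0,\infty)^3$, so that on the compact set $S$ they are bounded and bounded away from $0$. The native space $H_{k(\theta)}(U)$ is the reproducing kernel Hilbert space of $k(\theta)$ on $U$. $H^s(U)$, $s\ge0$, is the $L^2$-based Sobolev space of (possibly fractional) order $s$. Fill distance, separation radius and mesh ratio: $h_{D_N,U}=\sup_{u\in U}\min_{u^n\in D_N}\|u-u^n\|$, $q_{D_N,U}=\frac12\min_{i\ne j}\|u^i-u^j\|$, $\rho_{D_N,U}=h_{D_N,U}/q_{D_N,U}$. *)

theory Defs
  imports "HOL-Analysis.Analysis" "Jordan_Normal_Form.Gauss_Jordan_Elimination"
begin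

section \<open>Gaussian process regression\<close>

text \<open>Design points are given as a list \<open>D\<close> enumerating the design set. The vector and matrix
  operations are those of \<open>Jordan_Normal_Form\<close>, since the size \<open>N\<close> varies.\<close>

definition kernel_vec :: "('a \<Rightarrow> 'a \<Rightarrow> real) \<Rightarrow> 'a \<Rightarrow> 'a list \<Rightarrow> real Matrix.vec" where
  "kernel_vec k u D = Matrix.vec (length D) (\<lambda>i. k u (D ! i))"

definition kernel_mat :: "('a \<Rightarrow> 'a \<Rightarrow> real) \<Rightarrow> 'a list \<Rightarrow> real Matrix.mat" where
  "kernel_mat k D = Matrix.mat (length D) (length D) (\<lambda>(i, j). k (D ! i) (D ! j))"

definition predictive_cov :: "('a \<Rightarrow> 'a \<Rightarrow> real) \<Rightarrow> 'a list \<Rightarrow> 'a \<Rightarrow> 'a \<Rightarrow> real" where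
  "predictive_cov k D u u' =
     k u u' - Matrix.scalar_prod (kernel_vec k u D)
                (mult_mat_vec (the (mat_inverse (kernel_mat k D))) (kernel_vec k u' D))"

definition predictive_sd_L2 ::
    "(real^'d) set \<Rightarrow> (real^'d \<Rightarrow> real^'d \<Rightarrow> real) \<Rightarrow> (real^'d) list \<Rightarrow> real" where
  "predictive_sd_L2 U k D = sqrt (\<integral>u. predictive_cov k D u u \<partial>(lebesgue_on U))"

section \<open>Matern kernel\<close>

text \<open>Modified Bessel function of the second kind of real order, for \<open>x > 0\<close>, defined by the
  integral formula as in Wendland's Scattered Data Approximation.\<close>

definition bessel_K :: "real \<Rightarrow> real \<Rightarrow> real" where
  "bessel_K \<nu> x = (\<integral>t. exp (- x * cosh t) * cosh (\<nu> * t) \<partial>(lebesgue_on {0..}))"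

definition matern ::
    "real \<Rightarrow> real \<Rightarrow> real \<Rightarrow> 'a::real_normed_vector \<Rightarrow> 'a \<Rightarrow> real" where
  "matern \<sigma>sq l \<nu> u u' =
     (if u = u' then \<sigma>sq
      else \<sigma>sq / (Gamma \<nu> * 2 powr (\<nu> - 1)) * (norm (u - u') / l) powr \<nu>
             * bessel_K \<nu> (norm (u - u') / l))"

text \<open>A hyper-parameter is a tuple \<open>(\<theta>mean, \<sigma>\<^sup>2, \<lambda>, \<nu>)\<close>. If the prior mean has no hyper-parameters,
  the first component is a dummy.\<close>

type_synonym 'm hyper = "(real^'m) \<times> real \<times> real \<times> real"

definition matern_kernel :: "'m::finite hyper \<Rightarrow> real^'d \<Rightarrow> real^'d \<Rightarrow> real" where
  "matern_kernel \<theta> = (case \<theta> of (\<theta>mean, \<sigma>sq, l, \<nu>) \<Rightarrow> matern \<sigma>sq l \<nu>)"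

definition matern_order :: "'d::finite itself \<Rightarrow> 'm::finite hyper \<Rightarrow> real" where
  "matern_order _ \<theta> = (case \<theta> of (\<theta>mean, \<sigma>sq, l, \<nu>) \<Rightarrow> \<nu> + real CARD('d) / 2)"

section \<open>Reproducing kernel Hilbert spaces\<close>

text \<open>A function on \<open>X\<close> is represented by its extension by zero. \<open>H\<close> is the set of functions in
  the space and \<open>ip\<close> its inner product.\<close>

definition real_hilbert_function_space ::
    "'a set \<Rightarrow> ('a \<Rightarrow> real) set \<Rightarrow> (('a \<Rightarrow> real) \<Rightarrow> ('a \<Rightarrow> real) \<Rightarrow> real) \<Rightarrow> bool" where
  "real_hilbert_function_space X H ip \<longleftrightarrow>
     (\<forall>g\<in>H. \<forall>x. x \<notin> X \<longrightarrow> g x = 0) \<and>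
     (\<lambda>x. 0) \<in> H \<and>
     (\<forall>g\<in>H. \<forall>h\<in>H. (\<lambda>x. g x + h x) \<in> H) \<and>
     (\<forall>c. \<forall>g\<in>H. (\<lambda>x. c * g x) \<in> H) \<and>
     (\<forall>g\<in>H. \<forall>h\<in>H. ip g h = ip h g) \<and>
     (\<forall>f\<in>H. \<forall>g\<in>H. \<forall>h\<in>H. ip (\<lambda>x. f x + g x) h = ip f h + ip g h) \<and>
     (\<forall>c. \<forall>g\<in>H. \<forall>h\<in>H. ip (\<lambda>x. c * g x) h = c * ip g h) \<and>
     (\<forall>g\<in>H. 0 \<le> ip g g \<and> (ip g g = 0 \<longrightarrow> g = (\<lambda>x. 0))) \<and>
     (\<forall>s. (\<forall>n. s n \<in> H) \<and>
          (\<forall>e>0. \<exists>M::nat. \<forall>m\<ge>M. \<forall>n\<ge>M.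
             sqrt (ip (\<lambda>x. s m x - s n x) (\<lambda>x. s m x - s n x)) < e) \<longrightarrow>
        (\<exists>g\<in>H. (\<lambda>n. sqrt (ip (\<lambda>x. s n x - g x) (\<lambda>x. s n x - g x))) \<longlonglongrightarrow> 0))"

definition rkhs ::
    "'a set \<Rightarrow> ('a \<Rightarrow> 'a \<Rightarrow> real) \<Rightarrow> ('a \<Rightarrow> real) set \<Rightarrow> (('a \<Rightarrow> real) \<Rightarrow> ('a \<Rightarrow> real) \<Rightarrow> real) \<Rightarrow> bool"
  where
  "rkhs X k H ip \<longleftrightarrow>
     real_hilbert_function_space X H ip \<and>
     (\<forall>u\<in>X. (\<lambda>x. if x \<in> X then k x u else 0) \<in> H \<and>
        (\<forall>g\<in>H. ip g (\<lambda>x. if x \<in> X then k x u else 0) = g u))"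

section \<open>Sobolev spaces of fractional order\<close>

definition partial_deriv :: "'d::finite \<Rightarrow> (real^'d \<Rightarrow> real) \<Rightarrow> real^'d \<Rightarrow> real" where
  "partial_deriv i g x = frechet_derivative g (at x) (axis i 1)"

definition smooth :: "(real^'d::finite \<Rightarrow> real) \<Rightarrow> bool" where
  "smooth g \<longleftrightarrow> (\<forall>js x. fold partial_deriv js g differentiable (at x))"

definition test_function :: "(real^'d::finite) set \<Rightarrow> (real^'d \<Rightarrow> real) \<Rightarrow> bool" where
  "test_function \<Omega> \<phi> \<longleftrightarrow>
     smooth \<phi> \<and> compact (closure {x. \<phi> x \<noteq> 0}) \<and> closure {x. \<phi> x \<noteq> 0} \<subseteq> \<Omega>"

definition square_integrable_on :: "(real^'d::finite) set \<Rightarrow> (real^'d \<Rightarrow> real) \<Rightarrow> bool" where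
  "square_integrable_on \<Omega> g \<longleftrightarrow>
     g \<in> borel_measurable (lebesgue_on \<Omega>) \<and> integrable (lebesgue_on \<Omega>) (\<lambda>x. (g x)\<^sup>2)"

text \<open>A multi-index is a function \<open>\<alpha> :: 'd \<Rightarrow> nat\<close>. In the classical derivative of a test function,
  \<open>js\<close> ranges over the orders in which the partial derivatives counted by \<open>\<alpha>\<close> can be taken.\<close>

definition weak_deriv ::
    "(real^'d::finite) set \<Rightarrow> ('d \<Rightarrow> nat) \<Rightarrow> (real^'d \<Rightarrow> real) \<Rightarrow> (real^'d \<Rightarrow> real) \<Rightarrow> bool" where
  "weak_deriv \<Omega> \<alpha> g v \<longleftrightarrow>
     (\<forall>\<phi> js. test_function \<Omega> \<phi> \<and> (\<forall>i. count_list js i = \<alpha> i) \<longrightarrow>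
        (\<integral>x. g x * fold partial_deriv js \<phi> x \<partial>(lebesgue_on \<Omega>)) =
        (-1) ^ (\<Sum>i\<in>UNIV. \<alpha> i) * (\<integral>x. v x * \<phi> x \<partial>(lebesgue_on \<Omega>)))"

text \<open>A square integrable weak derivative; it is unique up to null sets when it exists.\<close>

definition wderiv ::
    "(real^'d::finite) set \<Rightarrow> ('d \<Rightarrow> nat) \<Rightarrow> (real^'d \<Rightarrow> real) \<Rightarrow> real^'d \<Rightarrow> real" where
  "wderiv \<Omega> \<alpha> g = (SOME v. square_integrable_on \<Omega> v \<and> weak_deriv \<Omega> \<alpha> g v)"

definition slobodeckij_integrand :: "real \<Rightarrow> (real^'d::finite \<Rightarrow> real) \<Rightarrow> (real^'d) \<times> (real^'d) \<Rightarrow> real" where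
  "slobodeckij_integrand r v =
     (\<lambda>(x, y). (v x - v y)\<^sup>2 / norm (x - y) powr (real CARD('d) + 2 * r))"

text \<open>\<open>H\<^sup>s(\<Omega>)\<close> for open \<open>\<Omega>\<close> and \<open>s \<ge> 0\<close>, with the Sobolev-Slobodeckij norm for \<open>s = n + r\<close>,
  \<open>n = \<lfloor>s\<rfloor>\<close>. Members are representatives, not equivalence classes, and their values outside \<open>\<Omega>\<close>
  are irrelevant.\<close>

definition sobolev_space :: "(real^'d::finite) set \<Rightarrow> real \<Rightarrow> (real^'d \<Rightarrow> real) set" where
  "sobolev_space \<Omega> s =
     {g. square_integrable_on \<Omega> g \<and>
         (\<forall>\<alpha>. (\<Sum>i\<in>UNIV. \<alpha> i) \<le> nat \<lfloor>s\<rfloor> \<longrightarrow> (\<exists>v. square_integrable_on \<Omega> v \<and> weak_deriv \<Omega> \<alpha> g v)) \<and>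
         (frac s > 0 \<longrightarrow>
            (\<forall>\<alpha>. (\<Sum>i\<in>UNIV. \<alpha> i) = nat \<lfloor>s\<rfloor> \<longrightarrow>
               integrable (lebesgue_on \<Omega> \<Otimes>\<^sub>M lebesgue_on \<Omega>)
                 (slobodeckij_integrand (frac s) (wderiv \<Omega> \<alpha> g))))}"

definition sobolev_norm :: "(real^'d::finite) set \<Rightarrow> real \<Rightarrow> (real^'d \<Rightarrow> real) \<Rightarrow> real" where
  "sobolev_norm \<Omega> s g =
     sqrt ((\<Sum>\<alpha> | (\<Sum>i\<in>UNIV. \<alpha> i) \<le> nat \<lfloor>s\<rfloor>. \<integral>x. (wderiv \<Omega> \<alpha> g x)\<^sup>2 \<partial>(lebesgue_on \<Omega>)) +
           (if frac s > 0 then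
              \<Sum>\<alpha> | (\<Sum>i\<in>UNIV. \<alpha> i) = nat \<lfloor>s\<rfloor>.
                \<integral>z. slobodeckij_integrand (frac s) (wderiv \<Omega> \<alpha> g) z
                  \<partial>(lebesgue_on \<Omega> \<Otimes>\<^sub>M lebesgue_on \<Omega>)
            else 0))"

text \<open>Isomorphic in the usual sense of the native space literature: the two spaces consist of the
  same functions (up to null sets) and have equivalent norms.\<close>

definition isomorphic_to_sobolev ::
    "(real^'d::finite \<Rightarrow> real) set \<Rightarrow> ((real^'d \<Rightarrow> real) \<Rightarrow> (real^'d \<Rightarrow> real) \<Rightarrow> real) \<Rightarrow>
     (real^'d) set \<Rightarrow> real \<Rightarrow> bool" where
  "isomorphic_to_sobolev H ip \<Omega> s \<longleftrightarrow>
     H \<subseteq> sobolev_space \<Omega> s \<and>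
     (\<forall>w\<in>sobolev_space \<Omega> s. \<exists>g\<in>H. AE x in lebesgue_on \<Omega>. g x = w x) \<and>
     (\<exists>c>0. \<exists>C. \<forall>g\<in>H. c * sobolev_norm \<Omega> s g \<le> sqrt (ip g g) \<and>
                         sqrt (ip g g) \<le> C * sobolev_norm \<Omega> s g)"

section \<open>Geometry of the domain and of the design points\<close>

text \<open>Locally \<open>U\<close> is the region on or above the graph of a Lipschitz function \<open>\<gamma>\<close> over the
  hyperplane orthogonal to a unit vector \<open>e\<close>.\<close>

definition lipschitz_boundary :: "'a::euclidean_space set \<Rightarrow> bool" where
  "lipschitz_boundary U \<longleftrightarrow>
     (\<forall>x\<in>frontier U. \<exists>e \<delta> L \<gamma>. norm e = 1 \<and> \<delta> > 0 \<and> L-lipschitz_on {z. inner z e = 0} \<gamma> \<and>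
        (\<forall>y\<in>ball x \<delta>. y \<in> U \<longleftrightarrow> \<gamma> (y - inner y e *\<^sub>R e) \<le> inner y e))"

definition cone_at :: "'a::euclidean_space \<Rightarrow> 'a \<Rightarrow> real \<Rightarrow> real \<Rightarrow> 'a set" where
  "cone_at x \<xi> \<phi> R = {x + t *\<^sub>R y | t y. norm y = 1 \<and> inner y \<xi> \<ge> cos \<phi> \<and> 0 \<le> t \<and> t \<le> R}"

definition interior_cone_condition :: "'a::euclidean_space set \<Rightarrow> bool" where
  "interior_cone_condition U \<longleftrightarrow>
     (\<exists>\<phi> R. 0 < \<phi> \<and> \<phi> < pi / 2 \<and> R > 0 \<and>
        (\<forall>x\<in>U. \<exists>\<xi>. norm \<xi> = 1 \<and> cone_at x \<xi> \<phi> R \<subseteq> U))"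

definition fill_distance :: "'a::real_normed_vector set \<Rightarrow> 'a set \<Rightarrow> real" where
  "fill_distance U D = (SUP u\<in>U. Min ((\<lambda>p. norm (u - p)) ` D))"

text \<open>Meaningful only if \<open>D\<close> has at least two points.\<close>

definition separation_radius :: "'a::real_normed_vector set \<Rightarrow> real" where
  "separation_radius D = Min {norm (p - q) | p q. p \<in> D \<and> q \<in> D \<and> p \<noteq> q} / 2"

definition mesh_ratio :: "'a::real_normed_vector set \<Rightarrow> 'a set \<Rightarrow> real" where
  "mesh_ratio U D = fill_distance U D / separation_radius D"

end

theory Submission
  imports Defs "Jordan_Normal_Form.Determinant"
begin

text \<open>The predictive variance at \<open>u\<close> is the minimum over all weights of the quadratic form of the kernel
  in the points \<open>u\<close> and \<open>D\<close>, with weight \<open>- 1\<close> at \<open>u\<close>, so it is enough to exhibit good weights. The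
  Matern kernel of smoothness \<open>\<nu>\<close> is the mixture of the Gaussians \<open>exp (- \<bar>x - y\<bar>\<^sup>2 / (4 l\<^sup>2 s))\<close> over a
  Gamma distributed \<open>s\<close> of shape \<open>\<nu>\<close>. If the weights annihilate polynomials of degree at most \<open>L\<close>, use
  points within distance \<open>O(h)\<close> of \<open>u\<close> and are bounded in \<open>l\<^sup>1\<close>, then a Taylor expansion of the exponential
  bounds the Gaussian form by a multiple of \<open>min 1 ((h\<^sup>2 / s) ^ (L + 1))\<close>; integrating against the Gamma
  density gives \<open>O(h powr (2 * \<nu>))\<close> for \<open>\<nu> < L + 1\<close>, uniformly on compact parameter sets. Such weights
  come from tensor Lagrange interpolation on a grid of mesh size proportional to \<open>h\<close> inside the cone at
  \<open>u\<close>, whose nodes are moved to nearby design points: with a large enough factor of proportionality this is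
  a small perturbation of the interpolation problem. Finally the mesh ratio is at least \<open>1\<close> for small
  \<open>h\<close>, and \<open>h \<le> 1\<close> disposes of \<open>\<epsilon>\<close> and of the exponents.\<close>

unbundle no vec_syntax

section \<open>Optimality of kriging weights\<close>

text \<open>With \<open>b\<close> the kernel vector and \<open>x\<close> the solution of
  \<open>K *\<^sub>v x = b\<close>, the right-hand side exceeds the predictive variance by the
  quadratic form of \<open>K\<close> at \<open>w - x\<close>, which is nonnegative.\<close>

lemma predictive_cov_le_quadratic_form:
  fixes k :: "'a \<Rightarrow> 'a \<Rightarrow> real"
  assumes sym: "\<And>x y. k x y = k y x"
    and pd: "\<And>c i. i < length D \<Longrightarrow> c i \<noteq> 0 \<Longrightarrow>
      (\<Sum>i<length D. \<Sum>j<length D. c i * c j * k (D ! i) (D ! j)) > 0"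
  shows "predictive_cov k D u u \<le> k u u - 2 * (\<Sum>i<length D. w i * k u (D ! i))
     + (\<Sum>i<length D. \<Sum>j<length D. w i * w j * k (D ! i) (D ! j))"
proof -
  define N where "N = length D"
  define K where "K = kernel_mat k D"
  define b where "b = kernel_vec k u D"
  have K: "K \<in> carrier_mat N N" and b: "b \<in> carrier_vec N"
    by (auto simp: K_def kernel_mat_def b_def kernel_vec_def N_def)
  have Kv: "(K *\<^sub>v v) $ i = (\<Sum>j<N. k (D ! i) (D ! j) * v $ j)"
    if "v \<in> carrier_vec N" "i < N" for v :: "real Matrix.vec" and i
    using that by (auto simp: K_def kernel_mat_def N_def Matrix.scalar_prod_def lessThan_atLeast0 
        intro!: sum.cong)
  \<comment> \<open>A nonzero vector annihilated by \<open>K\<close> would have quadratic form zero.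
    Invertibility is what gives \<open>the (mat_inverse K)\<close> its meaning.\<close>
  have "Determinant.det K \<noteq> 0"
  proof
    assume "Determinant.det K = 0"
    then obtain v where v: "v \<in> carrier_vec N" "v \<noteq> 0\<^sub>v N" "K *\<^sub>v v = 0\<^sub>v N"
      using det_0_iff_vec_prod_zero_field[OF K] by auto
    then obtain i where i: "i < N" "v $ i \<noteq> 0"
      by (metis carrier_vecD eq_vecI index_zero_vec(1,2))
    have "(\<Sum>i<N. \<Sum>j<N. v $ i * v $ j * k (D ! i) (D ! j)) = (\<Sum>i<N. v $ i * (K *\<^sub>v v) $ i)"
      using v(1) by (auto simp: Kv sum_distrib_left mult_ac intro!: sum.cong simp del: index_mult_mat_vec)
    also have "\<dots> = 0" by (simp add: v(3))
    finally show False using pd[of i "\<lambda>i. v $ i"] i by (simp add: N_def)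
  qed
  then have "K \<in> Units (ring_mat TYPE(real) N ())"
    by (rule det_non_zero_imp_unit[OF K])
  then obtain B where B: "mat_inverse K = Some B"
    using mat_inverse(1)[OF K, of "()"] by (cases "mat_inverse K") auto
  have B': "K * B = 1\<^sub>m N" "B \<in> carrier_mat N N"
    using mat_inverse(2)[OF K B] by auto
  define x where "x = B *\<^sub>v b"
  have x: "x \<in> carrier_vec N" using B' b by (auto simp: x_def)
  have Kx: "K *\<^sub>v x = b"
    using assoc_mult_mat_vec[OF K B'(2) b] B' b by (simp add: x_def)
  have eq: "(\<Sum>j<N. k (D ! i) (D ! j) * x $ j) = k u (D ! i)" if "i < N" for i
    using Kv[OF x that] that by (simp add: Kx b_def kernel_vec_def N_def)
  have cov: "predictive_cov k D u u = k u u - (\<Sum>i<N. x $ i * k u (D ! i))"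
    using x unfolding predictive_cov_def B[unfolded K_def] option.sel x_def[unfolded b_def, symmetric]
    by (auto simp: Matrix.scalar_prod_def kernel_vec_def N_def lessThan_atLeast0 mult.commute
         intro!: sum.cong)
  let ?q = "\<lambda>a c. \<Sum>i<N. \<Sum>j<N. a i * c j * k (D ! i) (D ! j)"
  have q1: "?q a (\<lambda>j. x $ j) = (\<Sum>i<N. a i * k u (D ! i))" for a
    by (auto simp: eq[symmetric] sum_distrib_left mult_ac intro!: sum.cong)
  have q2: "?q a c = ?q c a" for a c
    by (subst sum.swap) (auto intro!: sum.cong simp: sym mult_ac)
  \<comment> \<open>Completing the square at the minimiser \<open>x\<close>. The assumption
    \<open>pd\<close> speaks of nonzero vectors, so \<open>w = x\<close> is a separate case.\<close>
  have "0 \<le> ?q (\<lambda>i. w i - x $ i) (\<lambda>i. w i - x $ i)"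
  proof (cases "\<exists>i<N. w i - x $ i \<noteq> 0")
    case True then show ?thesis using pd[of _ "\<lambda>i. w i - x $ i"] by (auto simp: N_def intro: less_imp_le)
  next
    case False then show ?thesis by simp
  qed
  also have "\<dots> = ?q w w - ?q w (\<lambda>j. x $ j) - ?q (\<lambda>j. x $ j) w + ?q (\<lambda>j. x $ j) (\<lambda>j. x $ j)"
    by (simp add: algebra_simps sum.distrib sum_subtractf)
  also have "?q (\<lambda>j. x $ j) w = ?q w (\<lambda>j. x $ j)" by (rule q2)
  finally show ?thesis
    unfolding q1 cov by (simp add: N_def)
qed

section \<open>Gaussian quadratic forms\<close>

text \<open>Expanding the squared norm splits the Gaussian into a factor in \<open>x i\<close>, a
  factor in \<open>x j\<close> and the exponential of a multiple of their inner product. The first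
  two are absorbed into the weights; the third is a power series with nonnegative coefficients in
  the inner product.\<close>

lemma gaussian_quadratic_form_nonneg:
  fixes x :: "'i \<Rightarrow> 'a::euclidean_space" and w :: "'i \<Rightarrow> real"
  assumes s: "s \<ge> 0"
  shows "0 \<le> (\<Sum>i\<in>I. \<Sum>j\<in>I. w i * w j * exp (- s * (norm (x i - x j))\<^sup>2))"
proof -
  \<comment> \<open>Schur's product theorem for powers of a Gram matrix: one factor is expanded in
    coordinates and each coordinate is absorbed into the weights, so the induction varies
    \<open>w\<close>.\<close>
  have pow: "0 \<le> (\<Sum>i\<in>I. \<Sum>j\<in>I. w i * w j * (inner (x i) (x j)) ^ n)" for n and w :: "'i \<Rightarrow> real"
  proof (induction n arbitrary: w)
    case 0
    have "(\<Sum>i\<in>I. \<Sum>j\<in>I. w i * w j) = (\<Sum>i\<in>I. w i)\<^sup>2"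
      by (simp add: power2_eq_square sum_product)
    then show ?case by simp
  next
    case (Suc n)
    have "(\<Sum>i\<in>I. \<Sum>j\<in>I. w i * w j * (inner (x i) (x j)) ^ Suc n)
      = (\<Sum>i\<in>I. \<Sum>j\<in>I. \<Sum>b\<in>Basis. (w i * inner (x i) b) * (w j * inner (x j) b) * (inner (x i) (x j)) ^ n)"
    proof (intro sum.cong refl)
      fix i j
      have "w i * w j * (inner (x i) (x j)) ^ Suc n
        = w i * w j * (inner (x i) (x j)) ^ n * (\<Sum>b\<in>Basis. inner (x i) b * inner (x j) b)"
        by (simp add: euclidean_inner[of "x i" "x j", symmetric])
      also have "\<dots> = (\<Sum>b\<in>Basis. (w i * inner (x i) b) * (w j * inner (x j) b) * (inner (x i) (x j)) ^ n)"
        by (simp add: sum_distrib_left mult_ac)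
      finally show "w i * w j * (inner (x i) (x j)) ^ Suc n
        = (\<Sum>b\<in>Basis. (w i * inner (x i) b) * (w j * inner (x j) b) * (inner (x i) (x j)) ^ n)" .
    qed
    also have "\<dots> = (\<Sum>b\<in>Basis. \<Sum>i\<in>I. \<Sum>j\<in>I. (w i * inner (x i) b) * (w j * inner (x j) b) * (inner (x i) (x j)) ^ n)"
      by (subst sum.swap[of _ Basis I]) (intro sum.cong refl sum.swap)
    finally show ?case by (auto intro!: sum_nonneg Suc.IH)
  qed
  define v where "v i = w i * exp (- s * (norm (x i))\<^sup>2)" for i
  have "w i * w j * exp (- s * (norm (x i - x j))\<^sup>2) = v i * v j * exp (2 * s * inner (x i) (x j))" for i j
  proof -
    have "- s * (norm (x i - x j))\<^sup>2 = - s * (norm (x i))\<^sup>2 + - s * (norm (x j))\<^sup>2 + 2 * s * inner (x i) (x j)"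
      by (simp add: power2_norm_eq_inner inner_diff inner_commute algebra_simps)
    then show ?thesis by (simp only: v_def exp_add) simp
  qed
  then have "(\<Sum>i\<in>I. \<Sum>j\<in>I. w i * w j * exp (- s * (norm (x i - x j))\<^sup>2))
    = (\<Sum>i\<in>I. \<Sum>j\<in>I. v i * v j * exp (2 * s * inner (x i) (x j)))" by simp
  moreover have "(\<lambda>n. \<Sum>i\<in>I. \<Sum>j\<in>I. v i * v j * ((2 * s * inner (x i) (x j)) ^ n /\<^sub>R fact n)) sums \<dots>"
    by (intro sums_sum sums_mult exp_converges)
  moreover have "0 \<le> (\<Sum>i\<in>I. \<Sum>j\<in>I. v i * v j * ((2 * s * inner (x i) (x j)) ^ n /\<^sub>R fact n))" for n
  proof -
    have "(\<Sum>i\<in>I. \<Sum>j\<in>I. v i * v j * ((2 * s * inner (x i) (x j)) ^ n /\<^sub>R fact n))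
      = ((2 * s) ^ n / fact n) * (\<Sum>i\<in>I. \<Sum>j\<in>I. v i * v j * (inner (x i) (x j)) ^ n)"
      by (simp add: sum_distrib_left power_mult_distrib divide_inverse mult_ac)
    then show ?thesis using pow[of v n] s by simp
  qed
  ultimately show ?thesis
    using sums_le[OF _ sums_zero, of "\<lambda>n. \<Sum>i\<in>I. \<Sum>j\<in>I. v i * v j * ((2 * s * inner (x i) (x j)) ^ n /\<^sub>R fact n)"]
    by simp
qed

text \<open>The Lagrange remainder has its intermediate point in \<open>[-1, 1]\<close>, and
  \<open>3\<close> bounds \<open>exp 1\<close>.\<close>

lemma exp_taylor_remainder_unit:
  fixes z :: real
  assumes "0 \<le> z" "z \<le> 1"
  shows "\<bar>exp (- z) - (\<Sum>k<n. (- z) ^ k / fact k)\<bar> \<le> 3 * z ^ n"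
proof -
  obtain t where t: "\<bar>t\<bar> \<le> \<bar>- z\<bar>"
    "exp (- z) = (\<Sum>k<n. (- z) ^ k / fact k) + exp t / fact n * (- z) ^ n"
    using Maclaurin_exp_le[of "- z" n] by blast
  have "exp t \<le> exp 1" using t assms by simp
  then have "exp t \<le> 3" using exp_le by linarith
  moreover have "(1::real) \<le> fact n" by (simp add: fact_ge_1)
  ultimately have "exp t / fact n \<le> 3"
    by (smt (verit) divide_le_eq exp_gt_zero mult_le_cancel_left1)
  moreover have "\<bar>exp (- z) - (\<Sum>k<n. (- z) ^ k / fact k)\<bar> = exp t / fact n * z ^ n"
    using assms by (simp add: t(2) abs_mult power_abs)
  ultimately show ?thesis using mult_right_mono[of "exp t / fact n" 3 "z ^ n"] assms by simp
qed

section \<open>The Matern kernel as a Gamma mixture of Gaussians\<close>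

definition gamma_density :: "real \<Rightarrow> real \<Rightarrow> real" where
  "gamma_density \<nu> s = s powr (\<nu> - 1) / exp s / Gamma \<nu>"

lemma gamma_density_nonneg: "\<nu> > 0 \<Longrightarrow> 0 \<le> gamma_density \<nu> s"
  by (simp add: gamma_density_def Gamma_real_nonneg)

lemma gamma_density_has_integral:
  assumes "\<nu> > 0"
  shows "(gamma_density \<nu> has_integral 1) {0<..}"
proof -
  have "Gamma \<nu> > 0" using assms by (rule Gamma_real_pos)
  then have "(gamma_density \<nu> has_integral 1) {0..}"
    using has_integral_divide[OF Gamma_integral_real[OF assms], of "Gamma \<nu>"]
    by (simp add: gamma_density_def[abs_def])
  then have "((\<lambda>t. if t \<in> {0<..} then gamma_density \<nu> t else 0) has_integral 1) {0..}"
    by (rule has_integral_spike [of "{0}", rotated 2]) auto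
  also have "?this = ?thesis" by (subst has_integral_restrict) auto
  finally show ?thesis .
qed

lemma gamma_mixture_integrable:
  assumes \<nu>: "\<nu> > 0" and g: "continuous_on {0<..} g" and b: "\<And>s. s > 0 \<Longrightarrow> \<bar>g s\<bar> \<le> B"
  shows "(\<lambda>s. gamma_density \<nu> s * g s) absolutely_integrable_on {0<..}"
proof -
  have "continuous_on {0<..} (\<lambda>s. gamma_density \<nu> s * g s)"
    unfolding gamma_density_def using Gamma_real_pos[OF \<nu>] by (auto intro!: continuous_intros g)
  then have m: "(\<lambda>s. gamma_density \<nu> s * g s) \<in> borel_measurable (lebesgue_on {0<..})"
    by (rule continuous_imp_measurable_on_sets_lebesgue) auto
  have i: "(\<lambda>s. B * gamma_density \<nu> s) integrable_on {0<..}"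
    using has_integral_mult_right[OF gamma_density_has_integral[OF \<nu>], of B]
    by (auto simp: integrable_on_def)
  show ?thesis
  proof (rule measurable_bounded_by_integrable_imp_absolutely_integrable[OF m _ i])
    show "norm (gamma_density \<nu> s * g s) \<le> B * gamma_density \<nu> s" if "s \<in> {0<..}" for s
      using that b[of s] gamma_density_nonneg[OF \<nu>, of s] by (simp add: abs_mult mult.commute mult_right_mono)
  qed auto
qed

lemma bessel_K_mixture:
  assumes \<nu>: "\<nu> > 0" and x: "x > 0"
  shows "integral {0<..} (\<lambda>s. gamma_density \<nu> s * exp (- x\<^sup>2 / (4 * s)))
     = 2 * (x / 2) powr \<nu> * bessel_K \<nu> x / Gamma \<nu>"
proof -
  \<comment> \<open>the substitution \<open>s = (x / 2) e\<^sup>t\<close> turns \<open>s + x\<^sup>2 / (4 s)\<close> into \<open>x cosh t\<close>\<close>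
  let ?f = "\<lambda>s. gamma_density \<nu> s * exp (- x\<^sup>2 / (4 * s))"
  let ?g = "\<lambda>t. x / 2 * exp t"
  let ?E = "\<lambda>t. exp (- x * cosh t) * exp (\<nu> * t)"
  let ?c = "(x / 2) powr \<nu> / Gamma \<nu>"
  have range: "range ?g = {0::real<..}"
  proof (intro equalityI subsetI)
    fix y :: real assume "y \<in> {0<..}"
    then have "y = ?g (ln (2 * y / x))" using x by simp
    then show "y \<in> range ?g" by blast
  qed (use x in auto)
  \<comment> \<open>The map \<open>?g\<close> is its own derivative, so its absolute value is the
    Jacobian factor.\<close>
  have conv: "\<bar>?g t\<bar> * ?f (?g t) = ?c * ?E t" for t
  proof -
    have g: "?g t > 0" using x by simp
    have "x\<^sup>2 / (4 * ?g t) = x / 2 * exp (- t)"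
      using x by (simp add: exp_minus divide_simps power2_eq_square)
    then have "- x\<^sup>2 / (4 * ?g t) = - (x / 2 * exp (- t))"
      by (metis minus_divide_left)
    then have 1: "- x * cosh t = - ?g t + - x\<^sup>2 / (4 * ?g t)"
      unfolding cosh_field_def by argo
    have 2: "?g t * (?g t) powr (\<nu> - 1) = (x / 2) powr \<nu> * exp (\<nu> * t)"
    proof -
      have "?g t * (?g t) powr (\<nu> - 1) = (?g t) powr \<nu>"
        using g by (simp add: powr_diff)
      also have "\<dots> = (x / 2) powr \<nu> * (exp t) powr \<nu>"
        using x by (subst powr_mult) auto
      finally show ?thesis by (simp add: exp_powr_real mult.commute)
    qed
    have "\<bar>?g t\<bar> * ?f (?g t) = (?g t * (?g t) powr (\<nu> - 1)) * (exp (- ?g t) * exp (- x\<^sup>2 / (4 * ?g t))) / Gamma \<nu>"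
      unfolding gamma_density_def abs_of_pos[OF g] exp_minus[of "?g t"]
      by (simp only: divide_inverse mult_ac)
    then show ?thesis by (simp only: 2 1 exp_add) simp
  qed
  have f: "?f absolutely_integrable_on {0<..}"
    by (rule gamma_mixture_integrable[OF \<nu>, where B = 1]) (auto intro!: continuous_intros)
  have "(\<lambda>t. \<bar>?g t\<bar> * ?f (?g t)) absolutely_integrable_on UNIV \<and>
      integral UNIV (\<lambda>t. \<bar>?g t\<bar> * ?f (?g t)) = integral {0<..} ?f
    \<longleftrightarrow> ?f absolutely_integrable_on (range ?g) \<and> integral (range ?g) ?f = integral {0<..} ?f"
    by (rule has_absolute_integral_change_of_variables_1')
       (use x in \<open>auto intro!: derivative_eq_intros injI\<close>)
  then have *: "(\<lambda>t. ?c * ?E t) absolutely_integrable_on UNIV"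
     "integral UNIV (\<lambda>t. ?c * ?E t) = integral {0<..} ?f"
    unfolding conv range using f by auto
  have c: "?c > 0" using x Gamma_real_pos[OF \<nu>] by simp
  have E: "?E absolutely_integrable_on UNIV"
  proof -
    define K where "K = ?c"
    have "(\<lambda>t. 1 / K * (K * ?E t)) absolutely_integrable_on UNIV"
      using set_integrable_mult_right[of "1 / K", OF *(1)] by (simp only: K_def)
    moreover have "K \<noteq> 0" using c by (simp only: K_def)
    ultimately show ?thesis by simp
  qed
  have E_on: "?E absolutely_integrable_on S" if "S \<in> sets lebesgue" for S
    using set_integrable_subset[OF E that] by simp
  have "?E absolutely_integrable_on {..0} \<and> integral {..0} ?E = integral {..0} ?E"
    using E_on by auto
  then have R: "(\<lambda>t. ?E (- t)) absolutely_integrable_on {0..}"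
     "integral {0..} (\<lambda>t. ?E (- t)) = integral {..0} ?E"
    using has_absolute_integral_change_of_variables_1'[of "{0..}" uminus "\<lambda>_. - 1" ?E "integral {..0} ?E"]
      DERIV_minus[OF DERIV_ident]
    by (auto simp: inj_on_def)
  have E0: "?E absolutely_integrable_on {0..}" using E_on by auto
  \<comment> \<open>The substitution integrates over the whole line, \<open>bessel_K\<close> over a
    half-line. Folding \<open>t\<close> onto \<open>- t\<close> turns \<open>exp (\<nu> * t)\<close>
    into \<open>2 * cosh (\<nu> * t)\<close>, since \<open>cosh t\<close> is even.\<close>
  have C: "(\<lambda>t. exp (- x * cosh t) * cosh (\<nu> * t)) = (\<lambda>t. (?E t + ?E (- t)) / 2)"
    unfolding cosh_field_def[of "\<nu> * _"] by (simp add: distrib_left)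
  have "bessel_K \<nu> x = integral {0..} (\<lambda>t. (?E t + ?E (- t)) / 2)"
    unfolding bessel_K_def C
    by (rule lebesgue_integral_eq_integral)
       (use set_integral_add(1)[OF E0 R(1)] in \<open>simp_all add: integrable_restrict_space set_integrable_def\<close>)
  also have "\<dots> = (integral {0..} ?E + integral {0..} (\<lambda>t. ?E (- t))) / 2"
    by (simp only: integral_divide integral_add[OF set_lebesgue_integral_eq_integral(1)[OF E0]
          set_lebesgue_integral_eq_integral(1)[OF R(1)]])
  also have "integral {0..} (\<lambda>t. ?E (- t)) = integral {..0} ?E" by (rule R)
  also have "integral {0..} ?E + integral {..0} ?E = integral UNIV ?E"
  proof -
    have "(?E has_integral (integral {0..} ?E + integral {..0} ?E)) ({0..} \<union> {..0})"
      using E0 E_on[of "{..0}"]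
      by (intro has_integral_Un) (auto simp: absolutely_integrable_on_def intro: negligible_subset[of "{0}"])
    moreover have "{0..} \<union> {..0} = (UNIV :: real set)" by auto
    ultimately show ?thesis by (simp add: integral_unique)
  qed
  finally have "integral UNIV ?E = 2 * bessel_K \<nu> x" by simp
  then show ?thesis unfolding *(2)[symmetric] integral_mult_right by simp
qed

text \<open>On the diagonal this is the total mass of the Gamma density. Off it,
  \<open>bessel_K_mixture\<close> is taken at \<open>x = norm (u - u') / l\<close>, and
  \<open>2 * (x / 2) powr \<nu>\<close> equals
  \<open>x powr \<nu> / 2 powr (\<nu> - 1)\<close>.\<close>

lemma matern_mixture:
  assumes \<nu>: "\<nu> > 0" and l: "l > 0"
  shows "matern \<sigma>sq l \<nu> u u' = \<sigma>sq * integral {0<..} (\<lambda>s. gamma_density \<nu> s * exp (- (1 / (4 * l\<^sup>2 * s)) * (norm (u - u'))\<^sup>2))"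
proof -
  have eq: "- (1 / (4 * l\<^sup>2 * s)) * (norm (u - u'))\<^sup>2 = - (norm (u - u') / l)\<^sup>2 / (4 * s)" for s
    by (simp add: power_divide)
  show ?thesis
  proof (cases "u = u'")
    case True then show ?thesis
      using integral_unique[OF gamma_density_has_integral[OF \<nu>]] by (simp add: matern_def)
  next
    case False
    then have x: "norm (u - u') / l > 0" using l by simp
    show ?thesis
      unfolding eq bessel_K_mixture[OF \<nu> x] using x False
      using l by (simp add: matern_def powr_divide powr_mult powr_diff divide_simps)
  qed
qed

section \<open>Quadratic forms of weights annihilating polynomials\<close>

text \<open>A multi-index is a function on the whole space of which only the values on
  \<open>Basis\<close> matter.\<close>

definition monomial :: "('a::euclidean_space \<Rightarrow> nat) \<Rightarrow> 'a \<Rightarrow> real" where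
  "monomial \<alpha> x = (\<Prod>b\<in>Basis. inner x b ^ \<alpha> b)"

lemma monomial_mult_coordinate:
  assumes "b \<in> Basis"
  shows "monomial (\<alpha>(b := Suc (\<alpha> b))) x = inner x b * monomial \<alpha> x"
proof -
  have "monomial (\<alpha>(b := Suc (\<alpha> b))) x = inner x b ^ Suc (\<alpha> b) * (\<Prod>c\<in>Basis - {b}. inner x c ^ \<alpha> c)"
    unfolding monomial_def using assms by (subst prod.remove[of _ b]) auto
  moreover have "monomial \<alpha> x = inner x b ^ \<alpha> b * (\<Prod>c\<in>Basis - {b}. inner x c ^ \<alpha> c)"
    unfolding monomial_def using assms by (subst prod.remove[of _ b]) auto
  ultimately show ?thesis by simp
qed

lemma sum_fun_upd_Suc:
  assumes "b \<in> A" "finite A"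
  shows "(\<Sum>c\<in>A. (\<alpha>(b := Suc (\<alpha> b))) c) = Suc (\<Sum>c\<in>A. \<alpha> c)"
proof -
  have "(\<Sum>c\<in>A. (\<alpha>(b := Suc (\<alpha> b))) c) = Suc (\<alpha> b) + (\<Sum>c\<in>A - {b}. \<alpha> c)"
    using assms by (subst sum.remove[of A b]) auto
  then show ?thesis using sum.remove[OF assms(2,1), of \<alpha>] by simp
qed

text \<open>Every monomial of the expanded double sum has degree at most \<open>L\<close> in \<open>x i\<close> or in \<open>x j\<close>, so one
  of the two factors vanishes.\<close>

lemma annihilates_norm_power:
  fixes x :: "'i \<Rightarrow> 'a::euclidean_space"
  assumes ann: "\<And>\<alpha>. (\<Sum>b\<in>Basis. \<alpha> b) \<le> L \<Longrightarrow> (\<Sum>i\<in>I. w i * monomial \<alpha> (x i)) = 0"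
    and deg: "(\<Sum>b\<in>Basis. \<alpha> b) + (\<Sum>b\<in>Basis. \<beta> b) + 2 * k \<le> 2 * L + 1"
  shows "(\<Sum>i\<in>I. \<Sum>j\<in>I. w i * w j *
           (monomial \<alpha> (x i) * monomial \<beta> (x j) * ((norm (x i - x j))\<^sup>2) ^ k)) = 0"
  using deg
proof (induction k arbitrary: \<alpha> \<beta>)
  case 0
  have "(\<Sum>i\<in>I. \<Sum>j\<in>I. w i * w j * (monomial \<alpha> (x i) * monomial \<beta> (x j)))
    = (\<Sum>i\<in>I. w i * monomial \<alpha> (x i)) * (\<Sum>j\<in>I. w j * monomial \<beta> (x j))"
    by (simp add: sum_product mult_ac)
  moreover have "(\<Sum>b\<in>Basis. \<alpha> b) \<le> L \<or> (\<Sum>b\<in>Basis. \<beta> b) \<le> L" using 0 by linarith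
  ultimately show ?case using ann by auto
next
  case (Suc k)
  let ?t = "\<lambda>\<alpha> \<beta>. \<lambda>i j. w i * w j * (monomial \<alpha> (x i) * monomial \<beta> (x j) * ((norm (x i - x j))\<^sup>2) ^ k)"
  let ?u = "\<lambda>\<alpha> b. \<alpha>(b := Suc (\<alpha> b))"
  have sq: "(norm (x i - x j))\<^sup>2 = (\<Sum>b\<in>Basis. (inner (x i) b)\<^sup>2 - 2 * inner (x i) b * inner (x j) b + (inner (x j) b)\<^sup>2)" for i j
    unfolding power2_norm_eq_inner
    by (subst euclidean_inner) (simp add: inner_diff_left power2_eq_square algebra_simps)
  \<comment> \<open>Each coordinate of one squared norm contributes three terms. They raise the
    joint degree of the monomials by two while \<open>k\<close> drops by one, which preserves the
    degree bound.\<close>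
  have expand: "w i * w j * (monomial \<alpha> (x i) * monomial \<beta> (x j) * ((norm (x i - x j))\<^sup>2) ^ Suc k)
    = (\<Sum>b\<in>Basis. ?t (?u (?u \<alpha> b) b) \<beta> i j - 2 * ?t (?u \<alpha> b) (?u \<beta> b) i j + ?t \<alpha> (?u (?u \<beta> b) b) i j)" for i j
  proof -
    define P where "P = ((norm (x i - x j))\<^sup>2) ^ k"
    have "w i * w j * (monomial \<alpha> (x i) * monomial \<beta> (x j) * (P * (norm (x i - x j))\<^sup>2))
      = (\<Sum>b\<in>Basis. w i * w j * (monomial \<alpha> (x i) * monomial \<beta> (x j) * (P * 
         ((inner (x i) b)\<^sup>2 - 2 * inner (x i) b * inner (x j) b + (inner (x j) b)\<^sup>2))))"
      unfolding sq by (simp only: sum_distrib_left)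
    also have "\<dots> = (\<Sum>b\<in>Basis. w i * w j * (monomial (?u (?u \<alpha> b) b) (x i) * monomial \<beta> (x j) * P)
        - 2 * (w i * w j * (monomial (?u \<alpha> b) (x i) * monomial (?u \<beta> b) (x j) * P))
        + w i * w j * (monomial \<alpha> (x i) * monomial (?u (?u \<beta> b) b) (x j) * P))"
      by (intro sum.cong refl) (simp only: monomial_mult_coordinate, simp add: power2_eq_square algebra_simps)
    finally show ?thesis by (simp add: P_def mult.commute)
  qed
  have "(\<Sum>i\<in>I. \<Sum>j\<in>I. w i * w j * (monomial \<alpha> (x i) * monomial \<beta> (x j) * ((norm (x i - x j))\<^sup>2) ^ Suc k))
    = (\<Sum>b\<in>Basis. \<Sum>i\<in>I. \<Sum>j\<in>I. ?t (?u (?u \<alpha> b) b) \<beta> i j - 2 * ?t (?u \<alpha> b) (?u \<beta> b) i j + ?t \<alpha> (?u (?u \<beta> b) b) i j)"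
    unfolding expand by (subst sum.swap[of _ Basis I]) (intro sum.cong refl sum.swap)
  also have "\<dots> = (\<Sum>b\<in>Basis. (\<Sum>i\<in>I. \<Sum>j\<in>I. ?t (?u (?u \<alpha> b) b) \<beta> i j) - 2 * (\<Sum>i\<in>I. \<Sum>j\<in>I. ?t (?u \<alpha> b) (?u \<beta> b) i j)
     + (\<Sum>i\<in>I. \<Sum>j\<in>I. ?t \<alpha> (?u (?u \<beta> b) b) i j))"
    by (simp only: sum.distrib sum_subtractf sum_distrib_left)
  also have "\<dots> = (\<Sum>b\<in>(Basis::'a set). 0)"
  proof (intro sum.cong refl)
    fix b :: 'a assume b: "b \<in> Basis"
    note S = sum_fun_upd_Suc[OF b finite_Basis]
    have "(\<Sum>i\<in>I. \<Sum>j\<in>I. ?t (?u (?u \<alpha> b) b) \<beta> i j) = 0"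
      "(\<Sum>i\<in>I. \<Sum>j\<in>I. ?t (?u \<alpha> b) (?u \<beta> b) i j) = 0"
      "(\<Sum>i\<in>I. \<Sum>j\<in>I. ?t \<alpha> (?u (?u \<beta> b) b) i j) = 0"
      by (rule Suc.IH, use Suc.prems in \<open>simp only: S\<close>, simp)+
    then show "(\<Sum>i\<in>I. \<Sum>j\<in>I. ?t (?u (?u \<alpha> b) b) \<beta> i j) - 2 * (\<Sum>i\<in>I. \<Sum>j\<in>I. ?t (?u \<alpha> b) (?u \<beta> b) i j)
     + (\<Sum>i\<in>I. \<Sum>j\<in>I. ?t \<alpha> (?u (?u \<beta> b) b) i j) = 0" by (simp only:)
  qed
  finally show ?case by simp
qed

lemma abs_quadratic_form_le:
  fixes F :: "'i \<Rightarrow> 'i \<Rightarrow> real"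
  assumes "\<And>i j. i \<in> I \<Longrightarrow> j \<in> I \<Longrightarrow> \<bar>F i j\<bar> \<le> B"
  shows "\<bar>\<Sum>i\<in>I. \<Sum>j\<in>I. w i * w j * F i j\<bar> \<le> (\<Sum>i\<in>I. \<bar>w i\<bar>)\<^sup>2 * B"
proof -
  have "\<bar>\<Sum>i\<in>I. \<Sum>j\<in>I. w i * w j * F i j\<bar> \<le> (\<Sum>i\<in>I. \<Sum>j\<in>I. \<bar>w i\<bar> * \<bar>w j\<bar> * B)"
    by (intro order_trans[OF sum_abs] sum_mono)
       (use assms in \<open>auto simp: abs_mult intro!: order_trans[OF sum_abs] sum_mono mult_left_mono\<close>)
  also have "\<dots> = (\<Sum>i\<in>I. \<bar>w i\<bar>)\<^sup>2 * B"
  proof -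
    have "(\<Sum>i\<in>I. \<bar>w i\<bar>)\<^sup>2 = (\<Sum>i\<in>I. \<Sum>j\<in>I. \<bar>w i\<bar> * \<bar>w j\<bar>)"
      by (simp add: power2_eq_square sum_product)
    then show ?thesis by (simp only: sum_distrib_right)
  qed
  finally show ?thesis .
qed

text \<open>The Taylor terms of order at most \<open>L\<close> have joint degree at most
  \<open>2 * L\<close> in the two points, so the weights annihilate them. Only the remainder is
  left, and \<open>c * d \<le> 1\<close> puts its argument in the unit interval.\<close>

lemma gaussian_quadratic_form_small:
  fixes x :: "'i \<Rightarrow> 'a::euclidean_space"
  assumes ann: "\<And>\<alpha>. (\<Sum>b\<in>Basis. \<alpha> b) \<le> L \<Longrightarrow> (\<Sum>i\<in>I. w i * monomial \<alpha> (x i)) = 0"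
    and diam: "\<And>i j. i \<in> I \<Longrightarrow> j \<in> I \<Longrightarrow> (norm (x i - x j))\<^sup>2 \<le> d"
    and c: "0 \<le> c" "c * d \<le> 1"
  shows "\<bar>\<Sum>i\<in>I. \<Sum>j\<in>I. w i * w j * exp (- c * (norm (x i - x j))\<^sup>2)\<bar>
     \<le> (\<Sum>i\<in>I. \<bar>w i\<bar>)\<^sup>2 * (3 * (c * d) ^ Suc L)"
proof -
  let ?z = "\<lambda>i j. c * (norm (x i - x j))\<^sup>2"
  let ?T = "\<lambda>i j. \<Sum>k<Suc L. (- ?z i j) ^ k / fact k"
  have "(\<Sum>i\<in>I. \<Sum>j\<in>I. w i * w j * ?T i j)
    = (\<Sum>k<Suc L. \<Sum>i\<in>I. \<Sum>j\<in>I. w i * w j * ((- ?z i j) ^ k / fact k))"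
    unfolding sum_distrib_left
    by (subst sum.swap[of _ "{..<Suc L}" I]) (intro sum.cong refl sum.swap)
  also have "\<dots> = (\<Sum>k<Suc L. 0)"
  proof (intro sum.cong refl)
    fix k assume k: "k \<in> {..<Suc L}"
    have z: "(- ?z i j) ^ k = (- c) ^ k * ((norm (x i - x j))\<^sup>2) ^ k" for i j
      by (metis power_mult_distrib mult_minus_left)
    have "(\<Sum>i\<in>I. \<Sum>j\<in>I. w i * w j * ((- ?z i j) ^ k / fact k))
      = (- c) ^ k / fact k * (\<Sum>i\<in>I. \<Sum>j\<in>I. w i * w j * 
         (monomial (\<lambda>_. 0) (x i) * monomial (\<lambda>_. 0) (x j) * ((norm (x i - x j))\<^sup>2) ^ k))"
      unfolding sum_distrib_left z by (simp only: monomial_def power_0 prod.neutral_const mult_1 mult_ac times_divide_eq_right times_divide_eq_left)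
    also have "\<dots> = 0"
      by (subst annihilates_norm_power[OF ann]) (use k in auto)
    finally show "(\<Sum>i\<in>I. \<Sum>j\<in>I. w i * w j * ((- ?z i j) ^ k / fact k)) = 0" .
  qed
  finally have "(\<Sum>i\<in>I. \<Sum>j\<in>I. w i * w j * exp (- ?z i j))
    = (\<Sum>i\<in>I. \<Sum>j\<in>I. w i * w j * (exp (- ?z i j) - ?T i j))"
    by (simp only: right_diff_distrib sum_subtractf) simp
  also have "\<bar>\<dots>\<bar> \<le> (\<Sum>i\<in>I. \<bar>w i\<bar>)\<^sup>2 * (3 * (c * d) ^ Suc L)"
  proof (rule abs_quadratic_form_le)
    fix i j assume "i \<in> I" "j \<in> I"
    then have z: "0 \<le> ?z i j" "?z i j \<le> c * d" using diam c by (auto intro: mult_left_mono)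
    then have "\<bar>exp (- ?z i j) - ?T i j\<bar> \<le> 3 * ?z i j ^ Suc L"
      using exp_taylor_remainder_unit[of "?z i j" "Suc L"] c by linarith
    also have "\<dots> \<le> 3 * (c * d) ^ Suc L" using power_mono[OF z(2,1), of "Suc L"] by linarith
    finally show "\<bar>exp (- ?z i j) - ?T i j\<bar> \<le> 3 * (c * d) ^ Suc L" .
  qed
  finally show ?thesis by simp
qed

lemma matern_quadratic_form_integral:
  fixes x :: "'i \<Rightarrow> 'a::euclidean_space"
  assumes \<nu>: "\<nu> > 0" and l: "l > 0"
  shows "((\<lambda>s. gamma_density \<nu> s * (\<Sum>i\<in>I. \<Sum>j\<in>I. w i * w j *
             exp (- (1 / (4 * l\<^sup>2 * s)) * (norm (x i - x j))\<^sup>2)))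
     has_integral (\<Sum>i\<in>I. \<Sum>j\<in>I. w i * w j * matern 1 l \<nu> (x i) (x j))) {0<..}"
proof -
  let ?m = "\<lambda>i j s. gamma_density \<nu> s * exp (- (1 / (4 * l\<^sup>2 * s)) * (norm (x i - x j))\<^sup>2)"
  have "(?m i j has_integral matern 1 l \<nu> (x i) (x j)) {0<..}" for i j
  proof -
    have "?m i j absolutely_integrable_on {0<..}"
      by (rule gamma_mixture_integrable[OF \<nu>, where B = 1])
         (use l in \<open>auto intro!: continuous_intros\<close>)
    then show ?thesis
      unfolding matern_mixture[OF \<nu> l] by (simp add: absolutely_integrable_on_def integrable_integral)
  qed
  then have "((\<lambda>s. \<Sum>i\<in>I. \<Sum>j\<in>I. w i * w j * ?m i j s)
     has_integral (\<Sum>i\<in>I. \<Sum>j\<in>I. w i * w j * matern 1 l \<nu> (x i) (x j))) {0<..}"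
    by (cases "finite I") (auto intro!: has_integral_sum has_integral_mult_right)
  then show ?thesis by (simp add: sum_distrib_left mult_ac)
qed

text \<open>Distinct indices carry distinct points, so off the diagonal the exponent tends to minus
  infinity.\<close>

lemma gaussian_form_tendsto:
  fixes x :: "'i \<Rightarrow> 'a::euclidean_space"
  assumes "finite I" "inj_on x I" "l > 0"
  shows "((\<lambda>s. \<Sum>i\<in>I. \<Sum>j\<in>I. w i * w j * exp (- (1 / (4 * l\<^sup>2 * s)) * (norm (x i - x j))\<^sup>2))
     \<longlongrightarrow> (\<Sum>i\<in>I. (w i)\<^sup>2)) (at_right 0)"
proof -
  have "((\<lambda>s. exp (- (1 / (4 * l\<^sup>2 * s)) * (norm (x i - x j))\<^sup>2)) \<longlongrightarrow> (if i = j then 1 else 0)) (at_right 0)"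
    if "i \<in> I" "j \<in> I" for i j
  proof (cases "i = j")
    case False
    then have "x i \<noteq> x j" using that assms(2) by (auto simp: inj_on_def)
    then have c: "(norm (x i - x j))\<^sup>2 / (4 * l\<^sup>2) > 0" using assms(3) by simp
    have "filterlim (\<lambda>s. (norm (x i - x j))\<^sup>2 / (4 * l\<^sup>2) * inverse s) at_top (at_right 0)"
      by (rule filterlim_tendsto_pos_mult_at_top[OF tendsto_const c filterlim_inverse_at_top_right])
    then have "filterlim (\<lambda>s. - ((norm (x i - x j))\<^sup>2 / (4 * l\<^sup>2) * inverse s)) at_bot (at_right 0)"
      by (simp add: filterlim_uminus_at_bot)
    moreover have "(\<lambda>s. - ((norm (x i - x j))\<^sup>2 / (4 * l\<^sup>2) * inverse s))
        = (\<lambda>s. - (1 / (4 * l\<^sup>2 * s)) * (norm (x i - x j))\<^sup>2)"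
      by (rule ext) (simp add: divide_simps)
    ultimately show ?thesis
      using False filterlim_compose[OF exp_at_bot] by (simp only: if_False)
  qed simp
  then have "((\<lambda>s. \<Sum>i\<in>I. \<Sum>j\<in>I. w i * w j * exp (- (1 / (4 * l\<^sup>2 * s)) * (norm (x i - x j))\<^sup>2))
     \<longlongrightarrow> (\<Sum>i\<in>I. \<Sum>j\<in>I. w i * w j * (if i = j then 1 else 0))) (at_right 0)"
    by (intro tendsto_intros) auto
  also have "(\<Sum>i\<in>I. \<Sum>j\<in>I. w i * w j * (if i = j then 1 else 0)) = (\<Sum>i\<in>I. (w i)\<^sup>2)"
    using assms(1) by (simp add: power2_eq_square if_distrib sum.delta cong: if_cong)
  finally show ?thesis .
qed

text \<open>As \<open>s\<close> tends to \<open>0\<close>, the Gaussian matrix tends to the identity matrix.\<close>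

lemma matern_strictly_positive_definite:
  fixes x :: "'i \<Rightarrow> 'a::euclidean_space"
  assumes \<nu>: "\<nu> > 0" and l: "l > 0" and I: "finite I" "inj_on x I" and i: "i \<in> I" "w i \<noteq> 0"
  shows "(\<Sum>i\<in>I. \<Sum>j\<in>I. w i * w j * matern 1 l \<nu> (x i) (x j)) > 0"
proof -
  let ?G = "\<lambda>s. \<Sum>i\<in>I. \<Sum>j\<in>I. w i * w j * exp (- (1 / (4 * l\<^sup>2 * s)) * (norm (x i - x j))\<^sup>2)"
  let ?f = "\<lambda>s. gamma_density \<nu> s * ?G s"
  have int: "(?f has_integral (\<Sum>i\<in>I. \<Sum>j\<in>I. w i * w j * matern 1 l \<nu> (x i) (x j))) {0<..}"
    by (rule matern_quadratic_form_integral[OF \<nu> l])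
  have nn: "?f s \<ge> 0" if "s > 0" for s
    using gamma_density_nonneg[OF \<nu>] gaussian_quadratic_form_nonneg[of "1 / (4 * l\<^sup>2 * s)" w x I] that l by simp
  have "(\<Sum>i\<in>I. (w i)\<^sup>2) > 0"
    using I i by (intro sum_pos2[of _ i]) auto
  from order_tendstoD(1)[OF gaussian_form_tendsto[OF I l] this]
  obtain b where b: "b > 0" "\<And>s. 0 < s \<Longrightarrow> s < b \<Longrightarrow> ?G s > 0"
    unfolding eventually_at_right_field by auto
  \<comment> \<open>The integrand is nonnegative on the half-line and positive on this interval. The
    interval is kept away from \<open>0\<close>, where the density may be singular, so a continuity
    argument shows that its share of the integral is nonzero.\<close>
  have cont: "continuous_on {b/3..b/2} ?f"
    unfolding gamma_density_def using b(1) l Gamma_real_pos[OF \<nu>]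
    by (intro continuous_intros) auto
  have sub: "{b/3..b/2} \<subseteq> {0<..}" using b(1) by auto
  have fi: "?f integrable_on {b/3..b/2}" by (rule integrable_continuous_interval[OF cont])
  have pos: "?f s > 0" if "s \<in> {b/3..b/2}" for s
  proof -
    have "gamma_density \<nu> s > 0"
      using that b(1) Gamma_real_pos[OF \<nu>] by (auto simp: gamma_density_def)
    then show ?thesis using b that by auto
  qed
  have "integral {b/3..b/2} ?f \<noteq> 0"
  proof
    assume "integral {b/3..b/2} ?f = 0"
    then have 0: "(?f has_integral 0) (cbox (b/3) (b/2))"
      using integrable_integral[OF fi] by (simp only: cbox_interval)
    have "?f (b/3) = 0"
    proof (rule has_integral_0_cbox_imp_0[OF _ _ 0])
      show "continuous_on (cbox (b/3) (b/2)) ?f" using cont by (simp only: cbox_interval)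
      show "0 \<le> ?f s" if "s \<in> box (b/3) (b/2)" for s
        by (intro less_imp_le pos) (use that in auto)
    qed (use b(1) in auto)
    moreover have "?f (b/3) > 0" by (rule pos) (use b(1) in auto)
    ultimately show False by linarith
  qed
  moreover have "integral {b/3..b/2} ?f \<ge> 0"
    using pos by (intro integral_nonneg fi) (auto intro: less_imp_le)
  moreover have "integral {b/3..b/2} ?f \<le> integral {0<..} ?f"
    using int nn sub by (intro integral_subset_le fi) (auto simp: has_integral_iff)
  ultimately show ?thesis using integral_unique[OF int] by simp
qed

text \<open>Split at \<open>s = a\<close>, the mixture has two parts of size
  \<open>a powr \<nu>\<close>. The factor \<open>1 / \<nu>\<close> comes from integrating
  \<open>s powr (\<nu> - 1)\<close> near \<open>0\<close>; the other fraction comes from the tail,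
  which converges because \<open>\<nu> < L + 1\<close>.\<close>

lemma matern_quadratic_form_small:
  fixes x :: "'i \<Rightarrow> 'a::euclidean_space"
  assumes \<nu>: "0 < \<nu>" "\<nu> < real (Suc L)" and l: "l > 0" and d: "d > 0"
    and ann: "\<And>\<alpha>. (\<Sum>b\<in>Basis. \<alpha> b) \<le> L \<Longrightarrow> (\<Sum>i\<in>I. w i * monomial \<alpha> (x i)) = 0"
    and diam: "\<And>i j. i \<in> I \<Longrightarrow> j \<in> I \<Longrightarrow> (norm (x i - x j))\<^sup>2 \<le> d"
  shows "(\<Sum>i\<in>I. \<Sum>j\<in>I. w i * w j * matern 1 l \<nu> (x i) (x j))
     \<le> (\<Sum>i\<in>I. \<bar>w i\<bar>)\<^sup>2 / Gamma \<nu> * ((d / (4 * l\<^sup>2)) powr \<nu> * (1 / \<nu> + 3 / (real (Suc L) - \<nu>)))"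
proof -
  let ?G = "\<lambda>s. \<Sum>i\<in>I. \<Sum>j\<in>I. w i * w j * exp (- (1 / (4 * l\<^sup>2 * s)) * (norm (x i - x j))\<^sup>2)"
  define p where "p = real (Suc L)"
  define a where "a = d / (4 * l\<^sup>2)"
  define W where "W = (\<Sum>i\<in>I. \<bar>w i\<bar>)\<^sup>2"
  have a: "a > 0" using d l by (simp add: a_def)
  \<comment> \<open>the trivial bound of the Gaussian form is used for \<open>s \<le> a\<close>, the Taylor bound for \<open>s > a\<close>\<close>
  define h where "h s = (if s \<le> a then s powr (\<nu> - 1) else 3 * a powr p * s powr (\<nu> - 1 - p))" for s
  have "((\<lambda>s. s powr (\<nu> - 1)) has_integral a powr \<nu> / \<nu>) {0..a}"
    using has_integral_powr_from_0[of "\<nu> - 1" a] \<nu> a by simp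
  then have "(h has_integral a powr \<nu> / \<nu>) {0..a}"
    by (rule has_integral_eq[rotated]) (simp add: h_def)
  moreover have "(h has_integral 3 * a powr \<nu> / (p - \<nu>)) {a..}"
  \<comment> \<open>The two branches of \<open>h\<close> differ at \<open>s = a\<close>, a null
    set.\<close>
  proof (rule has_integral_spike[of "{a}"])
    have "a powr p * a powr (\<nu> - 1 - p + 1) = a powr \<nu>"
      using a by (simp add: powr_add[symmetric])
    moreover have "- (a powr (\<nu> - 1 - p + 1)) / (\<nu> - 1 - p + 1) = a powr (\<nu> - 1 - p + 1) / (p - \<nu>)"
      by (subst minus_divide_divide[symmetric]) (simp add: algebra_simps)
    ultimately have "3 * a powr p * (-(a powr (\<nu> - 1 - p + 1)) / (\<nu> - 1 - p + 1)) = 3 * a powr \<nu> / (p - \<nu>)"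
      by (metis mult.assoc times_divide_eq_right)
    then show "((\<lambda>s. 3 * a powr p * s powr (\<nu> - 1 - p)) has_integral 3 * a powr \<nu> / (p - \<nu>)) {a..}"
      using has_integral_mult_right[OF has_integral_powr_to_inf[of "\<nu> - 1 - p" a], of "3 * a powr p"] \<nu> a
      by (simp add: p_def)
  qed (auto simp: h_def)
  ultimately have "(h has_integral (a powr \<nu> / \<nu> + 3 * a powr \<nu> / (p - \<nu>))) ({0..a} \<union> {a..})"
    by (rule has_integral_Un) (auto intro: negligible_subset[of "{a}"])
  also have "{0..a} \<union> {a..} = {0..}" using a by auto
  finally have "(h has_integral (a powr \<nu> / \<nu> + 3 * a powr \<nu> / (p - \<nu>))) {0<..}"
    by (subst has_integral_spike_set_eq[of _ "{0..}"]) (auto intro: negligible_subset[of "{0}"])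
  then have hint: "((\<lambda>s. W / Gamma \<nu> * h s) has_integral W / Gamma \<nu> * (a powr \<nu> / \<nu> + 3 * a powr \<nu> / (p - \<nu>))) {0<..}"
    by (rule has_integral_mult_right)
  have Gam: "Gamma \<nu> > 0" using \<nu> by (simp add: Gamma_real_pos)
  have "(\<Sum>i\<in>I. \<Sum>j\<in>I. w i * w j * matern 1 l \<nu> (x i) (x j))
    \<le> W / Gamma \<nu> * (a powr \<nu> / \<nu> + 3 * a powr \<nu> / (p - \<nu>))"
  proof (rule has_integral_le[OF matern_quadratic_form_integral[OF \<nu>(1) l] hint])
    fix s :: real assume "s \<in> {0<..}"
    then have s: "s > 0" by simp
    \<comment> \<open>The exponential decay of the density is given up; the powers in
      \<open>h\<close> are integrable by themselves.\<close>
    have dens: "gamma_density \<nu> s \<le> s powr (\<nu> - 1) / Gamma \<nu>"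
    proof -
      have "s powr (\<nu> - 1) / exp s \<le> s powr (\<nu> - 1) / 1"
        using s by (intro divide_left_mono) auto
      then have "s powr (\<nu> - 1) / exp s / Gamma \<nu> \<le> s powr (\<nu> - 1) / 1 / Gamma \<nu>"
        by (rule divide_right_mono) (use Gam in simp)
      then show ?thesis by (simp only: gamma_density_def div_by_1)
    qed
    have W: "W \<ge> 0" by (simp add: W_def)
    show "gamma_density \<nu> s * ?G s \<le> W / Gamma \<nu> * h s"
    proof (cases "s \<le> a")
      case True
      have "\<bar>?G s\<bar> \<le> W * 1"
        unfolding W_def using s by (intro abs_quadratic_form_le) simp
      then have "?G s \<le> W" by linarith
      then have "gamma_density \<nu> s * ?G s \<le> gamma_density \<nu> s * W"
        by (rule mult_left_mono) (rule gamma_density_nonneg[OF \<nu>(1)])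
      also have "\<dots> \<le> s powr (\<nu> - 1) / Gamma \<nu> * W" by (rule mult_right_mono[OF dens W])
      also have "\<dots> = W / Gamma \<nu> * h s" using True by (simp add: h_def)
      finally show ?thesis .
    next
      case False
      have "\<bar>?G s\<bar> \<le> W * (3 * (1 / (4 * l\<^sup>2 * s) * d) ^ Suc L)"
        unfolding W_def
        by (rule gaussian_quadratic_form_small[OF ann diam])
           (use False s l in \<open>auto simp: a_def field_simps\<close>)
      also have "1 / (4 * l\<^sup>2 * s) * d = a / s" by (simp add: a_def)
      also have "(a / s) ^ Suc L = a powr p * s powr (- p)"
      proof -
        have "(a / s) ^ Suc L = (a / s) powr p"
          unfolding p_def by (rule powr_realpow[symmetric]) (use a s in simp)
        also have "\<dots> = a powr p / s powr p" using a s by (simp add: powr_divide)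
        finally show ?thesis by (simp only: powr_minus_divide) simp
      qed
      finally have "?G s \<le> W * (3 * (a powr p * s powr (- p)))" by linarith
      then have "gamma_density \<nu> s * ?G s \<le> gamma_density \<nu> s * (W * (3 * (a powr p * s powr (- p))))"
        by (rule mult_left_mono) (rule gamma_density_nonneg[OF \<nu>(1)])
      also have "\<dots> \<le> s powr (\<nu> - 1) / Gamma \<nu> * (W * (3 * (a powr p * s powr (- p))))"
        by (rule mult_right_mono[OF dens]) (use W in simp)
      also have "\<dots> = W / Gamma \<nu> * (3 * a powr p * (s powr (\<nu> - 1) * s powr (- p)))"
        by simp
      also have "s powr (\<nu> - 1) * s powr (- p) = s powr (\<nu> - 1 - p)"
        by (simp add: powr_add[symmetric])
      also have "W / Gamma \<nu> * (3 * a powr p * s powr (\<nu> - 1 - p)) = W / Gamma \<nu> * h s"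
        using False by (simp add: h_def)
      finally show ?thesis .
    qed
  qed
  then show ?thesis by (simp add: W_def a_def p_def field_simps)
qed

section \<open>Local polynomial reproduction in a cone\<close>

definition lagrange :: "nat \<Rightarrow> nat \<Rightarrow> real \<Rightarrow> real" where
  "lagrange L m x = (\<Prod>k\<in>{..L} - {m}. (x - real k) / (real m - real k))"

lemma lagrange_node:
  assumes "m \<le> L" "k \<le> L"
  shows "lagrange L m (real k) = (if k = m then 1 else 0)"
  using assms unfolding lagrange_def by (auto intro!: prod.neutral)

text \<open>Both sides are polynomials in \<open>x\<close> of degree at most \<open>L\<close> that
  agree at the \<open>L + 1\<close> nodes.\<close>

lemma lagrange_reproduces:
  assumes "degree q \<le> L"
  shows "(\<Sum>m\<le>L. poly q (real m) * lagrange L m x) = poly q x"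
proof -
  define l where "l m = (\<Prod>k\<in>{..L} - {m}. [:- real k / (real m - real k), 1 / (real m - real k):])" for m
  define P where "P = (\<Sum>m\<le>L. Polynomial.smult (poly q (real m)) (l m))"
  have l: "poly (l m) y = lagrange L m y" for m y
    unfolding l_def lagrange_def poly_prod by (intro prod.cong refl) (simp add: diff_divide_distrib)
  then have P: "poly P y = (\<Sum>m\<le>L. poly q (real m) * lagrange L m y)" for y
    by (simp add: P_def poly_sum)
  have "degree (l m) \<le> L" if "m \<le> L" for m
  proof -
    have "degree (l m) \<le> (\<Sum>k\<in>{..L} - {m}. degree [:- real k / (real m - real k), 1 / (real m - real k):])"
      unfolding l_def by (rule order_trans[OF degree_prod_sum_le]) (simp_all only: o_def order_refl finite_Diff finite_atMost)
    also have "\<dots> \<le> (\<Sum>k\<in>{..L} - {m}. 1)" by (intro sum_mono) simp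
    also have "\<dots> = L" using that by simp
    finally show ?thesis .
  qed
  then have "degree P \<le> L"
    unfolding P_def by (intro degree_sum_le) (auto intro: order_trans[OF degree_smult_le])
  moreover have "card (real ` {..L}) = Suc L" by (simp add: card_image)
  moreover have "poly P y = poly q y" if y: "y \<in> real ` {..L}" for y
  proof -
    obtain k where k: "k \<le> L" "y = real k" using y by auto
    then have "poly P y = (\<Sum>m\<le>L. if k = m then poly q (real m) else 0)"
      unfolding P by (intro sum.cong refl) (simp add: lagrange_node)
    then show ?thesis using k by simp
  qed
  ultimately have "P = q" using assms by (intro poly_eqI_degree[of "real ` {..L}"]) auto
  then show ?thesis using P[of x] by simp
qed

text \<open>\<open>PiE\<close> fixes the values off \<open>Basis\<close>, so the index set is finite
  and two different indices differ at some basis vector.\<close>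

definition grid :: "nat \<Rightarrow> ('a::euclidean_space \<Rightarrow> nat) set" where
  "grid L = PiE Basis (\<lambda>_. {..L})"

definition grid_point :: "('a::euclidean_space \<Rightarrow> nat) \<Rightarrow> 'a" where
  "grid_point j = (\<Sum>b\<in>Basis. real (j b) *\<^sub>R b)"

definition tensor_lagrange :: "nat \<Rightarrow> ('a::euclidean_space \<Rightarrow> nat) \<Rightarrow> 'a \<Rightarrow> real" where
  "tensor_lagrange L i y = (\<Prod>b\<in>Basis. lagrange L (i b) (inner y b))"

lemma finite_grid [simp]: "finite (grid L :: ('a::euclidean_space \<Rightarrow> nat) set)"
  by (simp add: grid_def finite_PiE)

lemma grid_le: "j \<in> grid L \<Longrightarrow> b \<in> Basis \<Longrightarrow> j b \<le> L"
  by (auto simp: grid_def PiE_def)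

lemma inner_grid_point [simp]: "b \<in> Basis \<Longrightarrow> inner (grid_point j) b = real (j b)"
  unfolding grid_point_def by (rule inner_sum_left_Basis)

lemma norm_grid_point_le:
  fixes j :: "'a::euclidean_space \<Rightarrow> nat"
  assumes "j \<in> grid L"
  shows "norm (grid_point j) \<le> real (L * DIM('a))"
proof -
  have "norm (grid_point j) \<le> (\<Sum>b\<in>(Basis::'a set). real (j b))"
    unfolding grid_point_def by (intro order_trans[OF norm_sum] sum_mono) simp
  also have "\<dots> \<le> (\<Sum>b\<in>(Basis::'a set). real L)"
    using grid_le[OF assms] by (intro sum_mono) simp
  finally show ?thesis by (simp add: mult.commute)
qed

lemma tensor_lagrange_grid_point:
  fixes i j :: "'a::euclidean_space \<Rightarrow> nat"
  assumes "i \<in> grid L" "j \<in> grid L"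
  shows "tensor_lagrange L i (grid_point j) = (if i = j then 1 else 0)"
proof (cases "i = j")
  case True
  then show ?thesis using assms by (simp add: tensor_lagrange_def lagrange_node grid_le)
next
  case False
  then obtain b where "b \<in> Basis" "i b \<noteq> j b"
    using PiE_ext[of i Basis "\<lambda>_. {..L}" j] assms by (auto simp: grid_def)
  then show ?thesis using assms False
    unfolding tensor_lagrange_def by (auto simp: lagrange_node grid_le intro!: prod_zero bexI[of _ b])
qed

text \<open>Multiplying the univariate identities over the coordinates and distributing the product
  of sums gives a sum over the grid. Products of univariate polynomials suffice, because translated
  monomials have this form.\<close>

lemma tensor_lagrange_reproduces:
  fixes y :: "'a::euclidean_space"
  assumes "\<And>b. b \<in> Basis \<Longrightarrow> degree (q b) \<le> L"
  shows "(\<Sum>i\<in>grid L. (\<Prod>b\<in>Basis. poly (q b) (real (i b))) * tensor_lagrange L i y)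
     = (\<Prod>b\<in>Basis. poly (q b) (inner y b))"
proof -
  have "(\<Prod>b\<in>Basis. poly (q b) (inner y b))
    = (\<Prod>b\<in>Basis. \<Sum>m\<le>L. poly (q b) (real m) * lagrange L m (inner y b))"
    by (intro prod.cong refl lagrange_reproduces[symmetric] assms)
  also have "\<dots> = (\<Sum>i\<in>grid L. \<Prod>b\<in>Basis. poly (q b) (real (i b)) * lagrange L (i b) (inner y b))"
    unfolding grid_def by (rule prod_sum_PiE) auto
  finally show ?thesis by (simp add: tensor_lagrange_def prod.distrib)
qed

lemma continuous_on_tensor_lagrange: "continuous_on S (tensor_lagrange L i)"
  unfolding tensor_lagrange_def[abs_def] lagrange_def divide_inverse by (intro continuous_intros)

section \<open>Stability of interpolation when nodes move\<close>

text \<open>Applying \<open>E\<close> at least halves the maximum over \<open>J\<close>, so the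
  iterates are summable; the factor \<open>2\<close> is the sum of the geometric series.\<close>

lemma perturbed_identity_solvable:
  fixes E :: "'i \<Rightarrow> 'i \<Rightarrow> real"
  assumes J: "finite J" and E: "\<And>i j. i \<in> J \<Longrightarrow> j \<in> J \<Longrightarrow> \<bar>E i j\<bar> \<le> \<eta>" "real (card J) * \<eta> \<le> 1 / 2"
    and v: "\<And>i. i \<in> J \<Longrightarrow> \<bar>v i\<bar> \<le> V"
  obtains w where "\<And>i. i \<in> J \<Longrightarrow> w i = v i + (\<Sum>j\<in>J. E i j * w j)"
    "\<And>i. i \<in> J \<Longrightarrow> \<bar>w i\<bar> \<le> 2 * V"
proof -
  \<comment> \<open>Neumann series\<close>
  define u where "u = rec_nat v (\<lambda>_ a i. \<Sum>j\<in>J. E i j * a j)"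
  have u0: "u 0 = v" and uS: "u (Suc n) i = (\<Sum>j\<in>J. E i j * u n j)" for n i
    by (simp_all add: u_def)
  have bound: "\<bar>u n i\<bar> \<le> V * (1 / 2) ^ n" if "i \<in> J" for n i
    using that
  proof (induction n arbitrary: i)
    case 0 then show ?case using v by (simp add: u0)
  next
    case (Suc n)
    have V: "V \<ge> 0" using v[OF Suc.prems] by linarith
    have "\<bar>u (Suc n) i\<bar> \<le> (\<Sum>j\<in>J. \<eta> * (V * (1 / 2) ^ n))"
      unfolding uS
      by (intro order_trans[OF sum_abs] sum_mono)
         (use Suc E(1) in \<open>auto simp: abs_mult intro!: mult_mono' simp del: times_divide_eq_right\<close>)
    also have "\<dots> = real (card J) * \<eta> * (V * (1 / 2) ^ n)" by simp
    also have "\<dots> \<le> 1 / 2 * (V * (1 / 2) ^ n)"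
      using V by (intro mult_right_mono E(2)) auto
    finally show ?case by simp
  qed
  have g: "summable (\<lambda>n. V * (1 / 2) ^ n)" by (intro summable_mult summable_geometric) simp
  have sm: "summable (\<lambda>n. \<bar>u n i\<bar>)" if "i \<in> J" for i
    by (rule summable_comparison_test'[OF g]) (use bound[OF that] in simp)
  have sm': "summable (\<lambda>n. u n i)" if "i \<in> J" for i
    using sm[OF that] by (rule summable_rabs_cancel)
  define w where "w i = (\<Sum>n. u n i)" for i
  show thesis
  proof (rule that[of w])
    fix i assume i: "i \<in> J"
    have "w i = u 0 i + (\<Sum>n. u (Suc n) i)"
      unfolding w_def using suminf_split_head[OF sm'[OF i]] by simp
    also have "(\<Sum>n. u (Suc n) i) = (\<Sum>j\<in>J. \<Sum>n. E i j * u n j)"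
      unfolding uS by (rule suminf_sum) (auto intro: summable_mult sm')
    also have "\<dots> = (\<Sum>j\<in>J. E i j * w j)"
      unfolding w_def by (intro sum.cong refl suminf_mult sm')
    finally show "w i = v i + (\<Sum>j\<in>J. E i j * w j)" by (simp add: u0)
    have "\<bar>w i\<bar> \<le> (\<Sum>n. \<bar>u n i\<bar>)" unfolding w_def by (rule summable_rabs[OF sm[OF i]])
    also have "\<dots> \<le> (\<Sum>n. V * (1 / 2) ^ n)"
      by (rule suminf_le[OF bound[OF i] sm[OF i] g])
    also have "\<dots> = 2 * V"
      by (subst suminf_mult) (auto simp: suminf_geometric summable_geometric)
    finally show "\<bar>w i\<bar> \<le> 2 * V" .
  qed
qed

text \<open>At the exact nodes \<open>a + grid_point j\<close> the weights for evaluation at the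
  origin are the tensor Lagrange values at \<open>- a\<close>. Moving the nodes by at most \<delta>
  changes the interpolation matrix, which is the identity at the exact nodes, only slightly. Both
  \<delta> and \<open>W\<close> are uniform in \<open>a\<close> and \<open>z\<close>.\<close>

lemma perturbed_grid_reproduction:
  fixes A :: real
  obtains \<delta> W where "\<delta> > 0"
    "\<And>a (z :: ('a::euclidean_space \<Rightarrow> nat) \<Rightarrow> 'a). norm a \<le> A \<Longrightarrow>
       (\<And>j. j \<in> grid L \<Longrightarrow> norm (z j - (a + grid_point j)) \<le> \<delta>) \<Longrightarrow>
       \<exists>w. (\<forall>j\<in>grid L. \<bar>w j\<bar> \<le> W) \<and>
         (\<forall>\<alpha>. (\<Sum>b\<in>Basis. \<alpha> b) \<le> L \<longrightarrow> (\<Sum>j\<in>grid L. w j * monomial \<alpha> (z j)) = monomial \<alpha> 0)"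
proof -
  let ?G = "grid L :: ('a \<Rightarrow> nat) set"
  \<comment> \<open>Entries of size \<eta> keep every row sum below one half.\<close>
  define \<eta> where "\<eta> = 1 / (2 * (1 + real (card ?G)))"
  have \<eta>: "\<eta> > 0" "real (card ?G) * \<eta> \<le> 1 / 2" by (auto simp: \<eta>_def field_simps)
  have "\<forall>\<^sub>F e in nhds 0. \<bar>tensor_lagrange L i (grid_point j + e) - tensor_lagrange L i (grid_point j)\<bar> < \<eta>"
    for i j :: "'a \<Rightarrow> nat"
  proof -
    have "isCont (\<lambda>e. tensor_lagrange L i (grid_point j + e)) 0"
      using continuous_on_compose2[OF continuous_on_tensor_lagrange[of UNIV L i], of UNIV "\<lambda>e. grid_point j + e"]
      by (auto simp: continuous_on_eq_continuous_at intro!: continuous_intros)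
    then have "((\<lambda>e. tensor_lagrange L i (grid_point j + e)) \<longlongrightarrow> tensor_lagrange L i (grid_point j)) (nhds 0)"
      using tendsto_at_iff_tendsto_nhds[of "\<lambda>e. tensor_lagrange L i (grid_point j + e)" 0]
      unfolding isCont_def by simp
    from tendstoD[OF this \<eta>(1)] show ?thesis by (simp add: dist_real_def)
  qed
  then have "\<forall>\<^sub>F e in nhds 0. \<forall>i\<in>?G. \<forall>j\<in>?G.
      \<bar>tensor_lagrange L i (grid_point j + e) - tensor_lagrange L i (grid_point j)\<bar> < \<eta>"
    by (intro eventually_ball_finite ballI finite_grid)
  then obtain d where d: "d > 0" "\<And>e i j. norm e < d \<Longrightarrow> i \<in> ?G \<Longrightarrow> j \<in> ?G \<Longrightarrow>
      \<bar>tensor_lagrange L i (grid_point j + e) - tensor_lagrange L i (grid_point j)\<bar> < \<eta>"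
    unfolding eventually_nhds_metric by (auto simp: dist_norm)
  \<comment> \<open>Compactness of the ball bounds the unperturbed weights uniformly in
    \<open>a\<close>.\<close>
  have "compact ((\<lambda>a. \<Sum>i\<in>?G. \<bar>tensor_lagrange L i (- a)\<bar>) ` cball 0 A)"
    by (intro compact_continuous_image continuous_intros
        continuous_on_compose2[OF continuous_on_tensor_lagrange[of UNIV]] compact_cball) auto
  from compact_imp_bounded[OF this] obtain V where
    V': "\<forall>y\<in>(\<lambda>a. \<Sum>i\<in>?G. \<bar>tensor_lagrange L i (- a)\<bar>) ` cball 0 A. norm y \<le> V"
    unfolding bounded_iff by blast
  have V: "(\<Sum>i\<in>?G. \<bar>tensor_lagrange L i (- a)\<bar>) \<le> V" if "norm a \<le> A" for a
    using bspec[OF V' imageI[of a]] that by simp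
  show thesis
  proof (rule that[of "d / 2" "2 * V"])
    fix a :: 'a and z :: "('a \<Rightarrow> nat) \<Rightarrow> 'a"
    assume a: "norm a \<le> A" and z: "\<And>j. j \<in> ?G \<Longrightarrow> norm (z j - (a + grid_point j)) \<le> d / 2"
    define E where "E i j = (if i = j then 1 else 0) - tensor_lagrange L i (z j - a)" for i j
    have Eb: "\<bar>E i j\<bar> \<le> \<eta>" if "i \<in> ?G" "j \<in> ?G" for i j
    proof -
      have "norm (z j - (a + grid_point j)) < d" using z[OF that(2)] d(1) by linarith
      from d(2)[OF this that] show ?thesis
        using tensor_lagrange_grid_point[OF that] by (simp add: E_def algebra_simps abs_minus_commute)
    qed
    have vb: "\<bar>tensor_lagrange L i (- a)\<bar> \<le> V" if "i \<in> ?G" for i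
      using V[OF a] member_le_sum[OF that, of "\<lambda>i. \<bar>tensor_lagrange L i (- a)\<bar>"] by simp
    obtain w where w: "\<And>i. i \<in> ?G \<Longrightarrow> w i = tensor_lagrange L i (- a) + (\<Sum>j\<in>?G. E i j * w j)"
      "\<And>i. i \<in> ?G \<Longrightarrow> \<bar>w i\<bar> \<le> 2 * V"
      by (rule perturbed_identity_solvable[of ?G E \<eta> "\<lambda>i. tensor_lagrange L i (- a)" V,
            OF finite_grid Eb \<eta>(2) vb]) (assumption+, rule that)
    \<comment> \<open>As \<open>E\<close> is the identity minus the interpolation matrix, the
      fixed-point equation for \<open>w\<close> says that \<open>w\<close> reproduces each tensor
      Lagrange polynomial at the origin. The monomials of degree at most \<open>L\<close> are
      combinations of these.\<close>
    have dual: "(\<Sum>j\<in>?G. w j * tensor_lagrange L i (z j - a)) = tensor_lagrange L i (- a)" if "i \<in> ?G" for i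
    proof -
      have "(\<Sum>j\<in>?G. E i j * w j) = (\<Sum>j\<in>?G. (if i = j then w j else 0) - w j * tensor_lagrange L i (z j - a))"
        by (intro sum.cong refl) (simp add: E_def algebra_simps)
      also have "\<dots> = w i - (\<Sum>j\<in>?G. w j * tensor_lagrange L i (z j - a))"
        using that by (simp add: sum_subtractf)
      finally show ?thesis using w(1)[OF that] by simp
    qed
    have "(\<Sum>j\<in>?G. w j * monomial \<alpha> (z j)) = monomial \<alpha> 0" if \<alpha>: "(\<Sum>b\<in>Basis. \<alpha> b) \<le> L" for \<alpha>
    proof -
      define q where "q b = [:inner a b, 1:] ^ \<alpha> b" for b
      have "degree (q b) \<le> L" if "b \<in> Basis" for b
      proof -
        have "degree (q b) \<le> \<alpha> b" unfolding q_def using degree_power_le[of "[:inner a b, 1:]" "\<alpha> b"] by simp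
        also have "\<dots> \<le> (\<Sum>b\<in>Basis. \<alpha> b)" using that by (intro member_le_sum) auto
        finally show ?thesis using \<alpha> by linarith
      qed
      note rep = tensor_lagrange_reproduces[of q L, OF this]
      have mono: "monomial \<alpha> x = (\<Prod>b\<in>Basis. poly (q b) (inner (x - a) b))" for x
        by (simp add: monomial_def q_def inner_diff_left)
      let ?c = "\<lambda>i :: 'a \<Rightarrow> nat. \<Prod>b\<in>Basis. poly (q b) (real (i b))"
      have "(\<Sum>j\<in>?G. w j * monomial \<alpha> (z j)) = (\<Sum>j\<in>?G. \<Sum>i\<in>?G. ?c i * (w j * tensor_lagrange L i (z j - a)))"
      proof -
        have "monomial \<alpha> (z j) = (\<Sum>i\<in>?G. ?c i * tensor_lagrange L i (z j - a))" for j
          unfolding mono by (rule rep[symmetric])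
        then show ?thesis
          by (simp only: sum_distrib_left) (intro sum.cong refl, rule mult.left_commute)
      qed
      also have "\<dots> = (\<Sum>i\<in>?G. ?c i * (\<Sum>j\<in>?G. w j * tensor_lagrange L i (z j - a)))"
        by (subst sum.swap) (simp add: sum_distrib_left)
      also have "\<dots> = (\<Sum>i\<in>?G. ?c i * tensor_lagrange L i (0 - a))"
        by (intro sum.cong refl) (simp add: dual)
      also have "\<dots> = monomial \<alpha> 0" unfolding mono by (rule rep)
      finally show ?thesis .
    qed
    then show "\<exists>w. (\<forall>j\<in>?G. \<bar>w j\<bar> \<le> 2 * V) \<and>
         (\<forall>\<alpha>. (\<Sum>b\<in>Basis. \<alpha> b) \<le> L \<longrightarrow> (\<Sum>j\<in>?G. w j * monomial \<alpha> (z j)) = monomial \<alpha> 0)"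
      using w(2) by blast
  qed (use d(1) in simp)
qed

section \<open>Transfer to design points inside a cone\<close>

text \<open>With \<kappa> the stated ratio, a perturbation of size at most
  \<open>\<kappa> * t\<close> leaves an axial component of at least
  \<open>t * (1 - \<kappa>)\<close> and a length of at most \<open>t * (1 + \<kappa>)\<close>. The
  ratio is chosen so that the former equals \<open>cos \<phi>\<close> times the latter.\<close>

lemma cone_at_contains_ball:
  fixes u \<xi> :: "'a::euclidean_space"
  assumes \<phi>: "0 < cos \<phi>" "cos \<phi> < 1" and \<xi>: "norm \<xi> = 1" and t: "0 \<le> t" "2 * t \<le> R"
    and v: "norm v \<le> (1 - cos \<phi>) / (1 + cos \<phi>) * t"
  shows "u + (t *\<^sub>R \<xi> + v) \<in> cone_at u \<xi> \<phi> R"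
    and "norm (t *\<^sub>R \<xi> + v) \<le> 2 * t"
proof -
  define \<kappa> where "\<kappa> = (1 - cos \<phi>) / (1 + cos \<phi>)"
  have \<kappa>: "\<kappa> \<le> 1" "1 - \<kappa> = cos \<phi> * (1 + \<kappa>)" using \<phi> by (auto simp: \<kappa>_def field_simps)
  define r where "r = norm (t *\<^sub>R \<xi> + v)"
  have r: "r \<le> t * (1 + \<kappa>)"
    using norm_triangle_ineq[of "t *\<^sub>R \<xi>" v] v \<xi> t by (simp add: r_def \<kappa>_def algebra_simps)
  have "t * (1 + \<kappa>) \<le> t * 2" using \<kappa> t by (intro mult_left_mono) auto
  then show r2: "norm (t *\<^sub>R \<xi> + v) \<le> 2 * t" using r by (simp add: r_def)
  have "\<bar>inner v \<xi>\<bar> \<le> \<kappa> * t" using Cauchy_Schwarz_ineq2[of v \<xi>] v \<xi> by (simp add: \<kappa>_def)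
  then have "inner (t *\<^sub>R \<xi> + v) \<xi> \<ge> t * (1 - \<kappa>)"
    using \<xi> by (simp add: inner_add_left dot_square_norm algebra_simps)
  moreover have "t * (1 - \<kappa>) \<ge> cos \<phi> * r"
    unfolding \<kappa>(2) using r \<phi> by (simp add: mult.left_commute mult_left_mono)
  ultimately have ge: "inner (t *\<^sub>R \<xi> + v) \<xi> \<ge> cos \<phi> * r" by linarith
  show "u + (t *\<^sub>R \<xi> + v) \<in> cone_at u \<xi> \<phi> R"
  proof (cases "r = 0")
    \<comment> \<open>The apex has no direction to normalise; the axis serves instead.\<close>
    case True
    then have "u + (t *\<^sub>R \<xi> + v) = u + 0 *\<^sub>R \<xi>" by (simp add: r_def)
    moreover have "cos \<phi> \<le> inner \<xi> \<xi>" using \<phi> \<xi> by (simp add: dot_square_norm)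
    ultimately show ?thesis
      unfolding cone_at_def using \<xi> t by (intro CollectI exI[of _ 0] exI[of _ \<xi>]) auto
  next
    case False
    then have rp: "r > 0" by (simp add: r_def)
    have "u + (t *\<^sub>R \<xi> + v) = u + r *\<^sub>R ((1 / r) *\<^sub>R (t *\<^sub>R \<xi> + v))" using rp by simp
    moreover have "norm ((1 / r) *\<^sub>R (t *\<^sub>R \<xi> + v)) = 1" using rp by (simp add: r_def)
    moreover have "cos \<phi> \<le> inner ((1 / r) *\<^sub>R (t *\<^sub>R \<xi> + v)) \<xi>"
      using ge rp by (simp only: inner_scaleR_left) (simp add: field_simps)
    moreover have "r \<le> R" using r2 t by (simp add: r_def)
    ultimately show ?thesis
      unfolding cone_at_def using rp
      by (intro CollectI exI[of _ r] exI[of _ "(1 / r) *\<^sub>R (t *\<^sub>R \<xi> + v)"]) auto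
  qed
qed

lemma monomial_scaleR: "monomial \<alpha> (s *\<^sub>R x) = s ^ (\<Sum>b\<in>Basis. \<alpha> b) * monomial \<alpha> x"
  by (simp add: monomial_def power_mult_distrib prod.distrib power_sum)

lemma monomial_zero: "monomial \<alpha> 0 = (if (\<Sum>b\<in>Basis. \<alpha> b) = 0 then 1 else 0)"
  by (auto simp: monomial_def zero_power intro!: prod_zero)

text \<open>A grid of mesh \<open>s\<close> is placed in the cone around height \<open>t\<close>,
  both proportional to \<open>h\<close>, and every node is replaced by a design point within
  \<open>h\<close>. Dividing by \<open>s\<close> gives a unit grid perturbed by at most
  \<open>h / s = \<delta>\<close>. The constants do not depend on \<open>u\<close>,
  \<open>U\<close>, \<open>P\<close> or \<open>h\<close>.\<close>

lemma cone_local_polynomial_reproduction: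
  fixes \<phi> R :: real
  assumes \<phi>: "0 < \<phi>" "\<phi> < pi / 2" and R: "R > 0"
  obtains K h1 where "K > 0" "h1 > 0"
    "\<forall>(u :: 'a::euclidean_space) \<xi> U P h. norm \<xi> = 1 \<and> cone_at u \<xi> \<phi> R \<subseteq> U \<and> 0 < h \<and> h \<le> h1 \<and>
       (\<forall>y\<in>U. \<exists>p\<in>P. norm (y - p) \<le> h) \<longrightarrow>
       (\<exists>x w. (\<forall>j\<in>grid L. x j \<in> P \<and> norm (x j - u) \<le> K * h \<and> \<bar>w j\<bar> \<le> K) \<and>
         (\<forall>\<alpha>. (\<Sum>b\<in>Basis. \<alpha> b) \<le> L \<longrightarrow>
            (\<Sum>j\<in>(grid L :: ('a \<Rightarrow> nat) set). w j * monomial \<alpha> (x j - u)) = monomial \<alpha> 0))"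
proof -
  have c: "0 < cos \<phi>" "cos \<phi> < 1"
    using \<phi> cos_gt_zero[of \<phi>] cos_monotone_0_pi[of 0 \<phi>] by auto
  define \<kappa> where "\<kappa> = (1 - cos \<phi>) / (1 + cos \<phi>)"
  have \<kappa>: "\<kappa> > 0" using c by (simp add: \<kappa>_def)
  \<comment> \<open>The ratio \<open>s / t\<close> of mesh to height, small enough that the grid
    stays in the ball of radius \<open>\<kappa> * t\<close>. After scaling, its corner is
    \<open>(1 / \<eta>) *\<^sub>R \<xi>\<close>, hence the bound \<open>1 / \<eta>\<close>
    below.\<close>
  define \<eta> where "\<eta> = \<kappa> / (1 + real (L * DIM('a)))"
  have \<eta>: "\<eta> > 0" using \<kappa> by (simp add: \<eta>_def add_pos_nonneg)
  have \<eta>\<kappa>: "\<eta> * norm (grid_point j) \<le> \<kappa>" if "j \<in> grid L" for j :: "'a \<Rightarrow> nat"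
  proof -
    have "\<eta> * norm (grid_point j) \<le> \<eta> * (1 + real (L * DIM('a)))"
      using norm_grid_point_le[OF that] \<eta> by (intro mult_left_mono) auto
    also have "\<dots> = \<kappa>" by (simp add: \<eta>_def add_nonneg_eq_0_iff)
    finally show ?thesis .
  qed
  obtain \<delta> W where \<delta>: "\<delta> > 0" and rep: "\<And>a (z :: ('a \<Rightarrow> nat) \<Rightarrow> 'a). norm a \<le> 1 / \<eta> \<Longrightarrow>
       (\<And>j. j \<in> grid L \<Longrightarrow> norm (z j - (a + grid_point j)) \<le> \<delta>) \<Longrightarrow>
       \<exists>w. (\<forall>j\<in>grid L. \<bar>w j\<bar> \<le> W) \<and>
         (\<forall>\<alpha>. (\<Sum>b\<in>Basis. \<alpha> b) \<le> L \<longrightarrow> (\<Sum>j\<in>grid L. w j * monomial \<alpha> (z j)) = monomial \<alpha> 0)"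
    using perturbed_grid_reproduction[of "1 / \<eta>" L] by blast
  define K where "K = max \<bar>W\<bar> (1 + 2 / (\<delta> * \<eta>))"
  show thesis
  \<comment> \<open>This limit on \<open>h\<close> amounts to \<open>2 * t \<le> R\<close>, and the
    second entry of \<open>K\<close> comes from \<open>h + 2 * t\<close>.\<close>
  proof (rule that[of K "R * (\<delta> * \<eta>) / 2"])
    have "0 < 2 / (\<delta> * \<eta>)" using \<delta> \<eta> by simp
    then show "K > 0" unfolding K_def by linarith
    show "0 < R * (\<delta> * \<eta>) / 2" using R \<delta> \<eta> by simp
    show "\<forall>(u :: 'a) \<xi> U P h. norm \<xi> = 1 \<and> cone_at u \<xi> \<phi> R \<subseteq> U \<and> 0 < h \<and> h \<le> R * (\<delta> * \<eta>) / 2 \<and>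
       (\<forall>y\<in>U. \<exists>p\<in>P. norm (y - p) \<le> h) \<longrightarrow>
       (\<exists>x w. (\<forall>j\<in>grid L. x j \<in> P \<and> norm (x j - u) \<le> K * h \<and> \<bar>w j\<bar> \<le> K) \<and>
         (\<forall>\<alpha>. (\<Sum>b\<in>Basis. \<alpha> b) \<le> L \<longrightarrow>
            (\<Sum>j\<in>(grid L :: ('a \<Rightarrow> nat) set). w j * monomial \<alpha> (x j - u)) = monomial \<alpha> 0))"
    proof (intro allI impI, elim conjE)
      fix u \<xi> :: 'a and U P :: "'a set" and h :: real
      assume \<xi>: "norm \<xi> = 1" and cone: "cone_at u \<xi> \<phi> R \<subseteq> U" and h: "0 < h" "h \<le> R * (\<delta> * \<eta>) / 2"
        and P: "\<forall>y\<in>U. \<exists>p\<in>P. norm (y - p) \<le> h"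
      define t where "t = h / (\<delta> * \<eta>)"
      define s where "s = h / \<delta>"
      have s: "s > 0" "h / s = \<delta>" and t: "t \<ge> 0" "2 * t \<le> R" and st: "s = t * \<eta>"
        using h \<delta> \<eta> by (auto simp: s_def t_def field_simps)
      define y where "y j = u + (t *\<^sub>R \<xi> + s *\<^sub>R grid_point j)" for j
      have y: "y j \<in> U" "norm (y j - u) \<le> 2 * t" if "j \<in> grid L" for j
      proof -
        have "norm (s *\<^sub>R grid_point j) \<le> (1 - cos \<phi>) / (1 + cos \<phi>) * t"
          using mult_left_mono[OF \<eta>\<kappa>[OF that] t(1)] t \<eta> by (simp add: st \<kappa>_def abs_mult mult_ac)
        from cone_at_contains_ball(1)[OF c \<xi> t this, of u] cone_at_contains_ball(2)[OF c \<xi> t this] show "y j \<in> U" "norm (y j - u) \<le> 2 * t"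
          using cone by (auto simp: y_def)
      qed
      have "\<forall>j\<in>grid L. \<exists>p\<in>P. norm (y j - p) \<le> h" using P y by blast
      then obtain x where x: "\<And>j. j \<in> grid L \<Longrightarrow> x j \<in> P" "\<And>j. j \<in> grid L \<Longrightarrow> norm (y j - x j) \<le> h"
        by metis
      define z where "z j = (1 / s) *\<^sub>R (x j - u)" for j
      have "norm ((1 / \<eta>) *\<^sub>R \<xi>) \<le> 1 / \<eta>" using \<xi> \<eta> by simp
      moreover have "norm (z j - ((1 / \<eta>) *\<^sub>R \<xi> + grid_point j)) \<le> \<delta>" if "j \<in> grid L" for j
      proof -
        have "t / s = 1 / \<eta>" using st s(1) \<eta> by (auto simp: field_simps)
        then have "z j - ((1 / \<eta>) *\<^sub>R \<xi> + grid_point j) = (1 / s) *\<^sub>R (x j - y j)"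
          using s(1) by (simp add: z_def y_def scaleR_diff_right scaleR_add_right)
        then have "norm (z j - ((1 / \<eta>) *\<^sub>R \<xi> + grid_point j)) = norm (y j - x j) / s"
          using s(1) by (simp add: norm_minus_commute)
        also have "\<dots> \<le> h / s" using x(2)[OF that] s(1) by (simp add: divide_right_mono)
        finally show ?thesis by (simp add: s)
      qed
      ultimately obtain w where w: "\<And>j. j \<in> grid L \<Longrightarrow> \<bar>w j\<bar> \<le> W"
        "\<And>\<alpha>. (\<Sum>b\<in>Basis. \<alpha> b) \<le> L \<Longrightarrow> (\<Sum>j\<in>grid L. w j * monomial \<alpha> (z j)) = monomial \<alpha> 0"
        using rep by blast
      \<comment> \<open>Undoing the scaling multiplies by \<open>s\<close> to the degree. This is
        harmless: the value at the origin vanishes unless the degree is zero.\<close>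
      have "(\<Sum>j\<in>(grid L :: ('a \<Rightarrow> nat) set). w j * monomial \<alpha> (x j - u)) = monomial \<alpha> 0" if "(\<Sum>b\<in>Basis. \<alpha> b) \<le> L" for \<alpha>
      proof -
        have "x j - u = s *\<^sub>R z j" for j using s(1) by (simp add: z_def)
        then have "(\<Sum>j\<in>(grid L :: ('a \<Rightarrow> nat) set). w j * monomial \<alpha> (x j - u))
          = s ^ (\<Sum>b\<in>Basis. \<alpha> b) * (\<Sum>j\<in>grid L. w j * monomial \<alpha> (z j))"
          by (simp add: monomial_scaleR sum_distrib_left mult_ac)
        then show ?thesis using w(2)[OF that] by (auto simp: monomial_zero)
      qed
      moreover have "norm (x j - u) \<le> K * h" if "j \<in> grid L" for j
      proof -
        have "norm (x j - u) \<le> norm (y j - x j) + norm (y j - u)"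
          using norm_triangle_ineq[of "x j - y j" "y j - u"] by (simp add: norm_minus_commute)
        also have "\<dots> \<le> h + 2 * t" using x(2) y(2) that by (intro add_mono) auto
        also have "\<dots> = (1 + 2 / (\<delta> * \<eta>)) * h" by (simp add: t_def algebra_simps)
        also have "\<dots> \<le> K * h" using h by (intro mult_right_mono) (auto simp: K_def)
        finally show ?thesis .
      qed
      moreover have "\<bar>w j\<bar> \<le> K" if "j \<in> grid L" for j
        using w(1)[OF that] by (auto simp: K_def)
      ultimately show "\<exists>x w. (\<forall>j\<in>grid L. x j \<in> P \<and> norm (x j - u) \<le> K * h \<and> \<bar>w j\<bar> \<le> K) \<and>
           (\<forall>\<alpha>. (\<Sum>b\<in>Basis. \<alpha> b) \<le> L \<longrightarrow>
              (\<Sum>j\<in>(grid L :: ('a \<Rightarrow> nat) set). w j * monomial \<alpha> (x j - u)) = monomial \<alpha> 0)"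
        using x(1) by (intro exI[of _ x] exI[of _ w]) auto
    qed
  qed
qed

section \<open>Uniform bound for the predictive variance\<close>

text \<open>Several indices in \<open>J\<close> may pick the same design point, so their weights are
  added up before \<open>predictive_cov_le_quadratic_form\<close> is applied. The index
  \<open>z\<close> stands for \<open>u\<close> itself.\<close>

lemma predictive_cov_le_weights:
  fixes k :: "'a \<Rightarrow> 'a \<Rightarrow> real" and x :: "'i \<Rightarrow> 'a"
  assumes sym: "\<And>x y. k x y = k y x"
    and pd: "\<And>c i. i < length D \<Longrightarrow> c i \<noteq> 0 \<Longrightarrow>
      (\<Sum>i<length D. \<Sum>j<length D. c i * c j * k (D ! i) (D ! j)) > 0"
    and D: "distinct D"
    and J: "finite J" "z \<notin> J" "\<And>j. j \<in> J \<Longrightarrow> x j \<in> set D" and z: "x z = u" "v z = - 1"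
  shows "predictive_cov k D u u \<le> (\<Sum>i\<in>insert z J. \<Sum>j\<in>insert z J. v i * v j * k (x i) (x j))"
proof -
  define w where "w i = (\<Sum>j\<in>J. if x j = D ! i then v j else 0)" for i
  have red: "(\<Sum>i<length D. w i * F (D ! i)) = (\<Sum>j\<in>J. v j * F (x j))" for F :: "'a \<Rightarrow> real"
  proof -
    have "(\<Sum>i<length D. w i * F (D ! i)) = (\<Sum>j\<in>J. \<Sum>i<length D. (if x j = D ! i then v j * F (x j) else 0))"
      unfolding w_def sum_distrib_right
      by (subst sum.swap) (intro sum.cong refl, simp)
    also have "\<dots> = (\<Sum>j\<in>J. v j * F (x j))"
    proof (intro sum.cong refl)
      fix j assume "j \<in> J"
      then obtain m where m: "m < length D" "x j = D ! m" using J(3) by (metis in_set_conv_nth)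
      then have "(\<Sum>i<length D. (if x j = D ! i then v j * F (x j) else 0))
        = (\<Sum>i<length D. (if m = i then v j * F (x j) else 0))"
        using D by (intro sum.cong refl) (auto simp: nth_eq_iff_index_eq)
      then show "(\<Sum>i<length D. (if x j = D ! i then v j * F (x j) else 0)) = v j * F (x j)"
        using m by simp
    qed
    finally show ?thesis .
  qed
  have "(\<Sum>i<length D. \<Sum>j<length D. w i * w j * k (D ! i) (D ! j))
    = (\<Sum>i<length D. w i * (\<Sum>j<length D. w j * k (D ! i) (D ! j)))"
    by (simp add: sum_distrib_left mult.assoc)
  also have "\<dots> = (\<Sum>i\<in>J. v i * (\<Sum>j\<in>J. v j * k (x i) (x j)))"
    unfolding red[of "k _"] by (rule red[of "\<lambda>y. \<Sum>j\<in>J. v j * k y (x j)"])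
  also have "\<dots> = (\<Sum>i\<in>J. \<Sum>j\<in>J. v i * v j * k (x i) (x j))"
    by (simp add: sum_distrib_left mult.assoc)
  finally have q: "(\<Sum>i<length D. \<Sum>j<length D. w i * w j * k (D ! i) (D ! j)) = \<dots>" .
  have "(\<Sum>i\<in>insert z J. \<Sum>j\<in>insert z J. v i * v j * k (x i) (x j))
    = k u u - 2 * (\<Sum>j\<in>J. v j * k u (x j)) + (\<Sum>i\<in>J. \<Sum>j\<in>J. v i * v j * k (x i) (x j))"
  proof -
    have "(\<Sum>j\<in>J. v j * k (x j) u) = (\<Sum>j\<in>J. v j * k u (x j))"
      by (intro sum.cong refl) (simp only: sym[of _ u])
    then show ?thesis using J z by (simp add: sum.distrib sum_negf sum_subtractf)
  qed
  then show ?thesis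
    using predictive_cov_le_quadratic_form[of k D u w, OF sym pd] by (simp only: red q)
qed

lemma matern_commute: "matern \<sigma>sq l \<nu> x y = matern \<sigma>sq l \<nu> y x"
  by (simp add: matern_def norm_minus_commute eq_commute)

lemma matern_scale: "matern \<sigma>sq l \<nu> x y = \<sigma>sq * matern 1 l \<nu> x y"
  by (simp add: matern_def)

lemma matern_translate: "matern \<sigma>sq l \<nu> (x - u) (y - u) = matern \<sigma>sq l \<nu> x y"
  by (simp add: matern_def)

text \<open>The reciprocal Gamma function is continuous, hence bounded on a compact
  interval.\<close>

lemma bounded_inverse_Gamma:
  fixes a b :: real
  assumes "0 < a"
  obtains M where "M > 0" "\<And>\<nu>. a \<le> \<nu> \<Longrightarrow> \<nu> \<le> b \<Longrightarrow> 1 / Gamma \<nu> \<le> M"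
proof -
  have "compact (rGamma ` {a..b})"
    by (intro compact_continuous_image continuous_intros) auto
  then obtain M where M: "\<And>y. y \<in> rGamma ` {a..b} \<Longrightarrow> norm y \<le> M" "M > 0"
    using compact_imp_bounded bounded_pos by metis
  show thesis
  proof (rule that[of M])
    fix \<nu> assume "a \<le> \<nu>" "\<nu> \<le> b"
    then have "norm (rGamma \<nu>) \<le> M" by (intro M imageI) simp
    then have "rGamma \<nu> \<le> M" by (simp only: real_norm_def abs_le_iff)
    then show "1 / Gamma \<nu> \<le> M" by (simp add: rGamma_inverse_Gamma divide_inverse)
  qed (rule M)
qed

text \<open>Reproduction weights at design points near \<open>u\<close>, together with
  \<open>- 1\<close> at \<open>u\<close>, annihilate polynomials up to degree \<open>L\<close> and
  live on a set of diameter at most \<open>2 * K * h\<close>. The constants depend only on bounds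
  for the parameters, so the estimates may vary freely with the number of points.\<close>

lemma matern_predictive_cov_le:
  fixes U :: "'a::euclidean_space set"
  assumes U: "interior_cone_condition U" and \<nu>01: "0 < \<nu>\<^sub>0" and l0: "0 < l\<^sub>0"
  obtains C h\<^sub>1 where "C \<ge> 0" "h\<^sub>1 > 0"
    "\<forall>\<sigma>sq l \<nu> D h u. 0 < \<sigma>sq \<and> \<sigma>sq \<le> \<sigma>\<^sub>1 \<and> l\<^sub>0 \<le> l \<and> \<nu>\<^sub>0 \<le> \<nu> \<and> \<nu> \<le> \<nu>\<^sub>1 \<and> distinct D \<and>
       (\<forall>y\<in>U. \<exists>p\<in>set D. norm (y - p) \<le> h) \<and> 0 < h \<and> h \<le> h\<^sub>1 \<and> u \<in> U \<longrightarrow>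
       predictive_cov (matern \<sigma>sq l \<nu>) D u u \<le> C * h powr (2 * \<nu>)"
proof -
  obtain \<phi> R where \<phi>: "0 < \<phi>" "\<phi> < pi / 2" "R > 0"
    and cone: "\<And>x. x \<in> U \<Longrightarrow> \<exists>\<xi>. norm \<xi> = 1 \<and> cone_at x \<xi> \<phi> R \<subseteq> U"
    using U unfolding interior_cone_condition_def by blast
  \<comment> \<open>One degree serves every \<nu> in the range and keeps
    \<open>L + 1 - \<nu>\<close> away from zero.\<close>
  define L where "L = nat \<lceil>\<nu>\<^sub>1\<rceil>"
  let ?G = "grid L :: ('a \<Rightarrow> nat) set"
  have L: "\<nu>\<^sub>1 < real (Suc L)" unfolding L_def by linarith
  obtain K h1 where K: "K > 0" and h1: "h1 > 0"
    and rep: "\<forall>(u :: 'a) \<xi> U P h. norm \<xi> = 1 \<and> cone_at u \<xi> \<phi> R \<subseteq> U \<and> 0 < h \<and> h \<le> h1 \<and>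
       (\<forall>y\<in>U. \<exists>p\<in>P. norm (y - p) \<le> h) \<longrightarrow>
       (\<exists>x w. (\<forall>j\<in>grid L. x j \<in> P \<and> norm (x j - u) \<le> K * h \<and> \<bar>w j\<bar> \<le> K) \<and>
         (\<forall>\<alpha>. (\<Sum>b\<in>Basis. \<alpha> b) \<le> L \<longrightarrow> (\<Sum>j\<in>?G. w j * monomial \<alpha> (x j - u)) = monomial \<alpha> 0))"
    by (rule cone_local_polynomial_reproduction[OF \<phi>, where 'a = 'a and L = L]) (rule that)
  obtain M where M: "M > 0" "\<And>\<nu>. \<nu>\<^sub>0 \<le> \<nu> \<Longrightarrow> \<nu> \<le> \<nu>\<^sub>1 \<Longrightarrow> 1 / Gamma \<nu> \<le> M"
    using bounded_inverse_Gamma[OF \<nu>01, of \<nu>\<^sub>1] by blast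
  define T where "T = 1 + real (card ?G) * K"
  \<comment> \<open>A base of at least \<open>1\<close> lets the exponent \<open>2 * \<nu>\<close>
    be raised to its largest value. The absolute value in \<open>C\<close> gives
    \<open>C \<ge> 0\<close> whatever the sign of \<open>\<sigma>\<^sub>1\<close>.\<close>
  define B where "B = max 1 (K / l\<^sub>0)"
  define Q where "Q = 1 / \<nu>\<^sub>0 + 3 / (real (Suc L) - \<nu>\<^sub>1)"
  define C where "C = \<bar>\<sigma>\<^sub>1\<bar> * (T\<^sup>2 * M * (B powr (2 * \<nu>\<^sub>1) * Q))"
  have T: "T \<ge> 0" using K by (simp add: T_def)
  have Q: "Q \<ge> 0" using \<nu>01 L by (simp add: Q_def)
  have B: "B \<ge> 1" by (simp add: B_def)
  show thesis
  proof (rule that[of C h1])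
    show "C \<ge> 0" using M(1) Q by (simp add: C_def)
    show "h1 > 0" by (rule h1)
    show "\<forall>\<sigma>sq l \<nu> D h u. 0 < \<sigma>sq \<and> \<sigma>sq \<le> \<sigma>\<^sub>1 \<and> l\<^sub>0 \<le> l \<and> \<nu>\<^sub>0 \<le> \<nu> \<and> \<nu> \<le> \<nu>\<^sub>1 \<and> distinct D \<and>
       (\<forall>y\<in>U. \<exists>p\<in>set D. norm (y - p) \<le> h) \<and> 0 < h \<and> h \<le> h1 \<and> u \<in> U \<longrightarrow>
       predictive_cov (matern \<sigma>sq l \<nu>) D u u \<le> C * h powr (2 * \<nu>)"
    proof (intro allI impI, elim conjE)
      fix \<sigma>sq l \<nu> h :: real and D :: "'a list" and u :: 'a
      assume \<sigma>: "0 < \<sigma>sq" "\<sigma>sq \<le> \<sigma>\<^sub>1" and l: "l\<^sub>0 \<le> l" and \<nu>: "\<nu>\<^sub>0 \<le> \<nu>" "\<nu> \<le> \<nu>\<^sub>1" and D: "distinct D"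
        and near: "\<forall>y\<in>U. \<exists>p\<in>set D. norm (y - p) \<le> h" and h: "0 < h" "h \<le> h1" and u: "u \<in> U"
      have pos: "\<nu> > 0" "l > 0" "\<nu> < real (Suc L)" using \<nu> \<nu>01 l l0 L by linarith+
      obtain \<xi> where \<xi>: "norm \<xi> = 1" "cone_at u \<xi> \<phi> R \<subseteq> U" using cone[OF u] by blast
      have "\<exists>x w. (\<forall>j\<in>?G. x j \<in> set D \<and> norm (x j - u) \<le> K * h \<and> \<bar>w j\<bar> \<le> K) \<and>
         (\<forall>\<alpha>. (\<Sum>b\<in>Basis. \<alpha> b) \<le> L \<longrightarrow> (\<Sum>j\<in>?G. w j * monomial \<alpha> (x j - u)) = monomial \<alpha> 0)"
        by (rule rep[THEN spec[of _ u], THEN spec[of _ \<xi>], THEN spec[of _ U], THEN spec[of _ "set D"],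
              THEN spec[of _ h], THEN mp]) (intro conjI \<xi> h near)
      then obtain x w where xw: "\<forall>j\<in>?G. x j \<in> set D \<and> norm (x j - u) \<le> K * h \<and> \<bar>w j\<bar> \<le> K"
        and ann: "\<forall>\<alpha>. (\<Sum>b\<in>Basis. \<alpha> b) \<le> L \<longrightarrow> (\<Sum>j\<in>?G. w j * monomial \<alpha> (x j - u)) = monomial \<alpha> 0"
        by (elim exE conjE) (rule that)
      have x: "x j \<in> set D" "norm (x j - u) \<le> K * h" and w: "\<bar>w j\<bar> \<le> K" if "j \<in> ?G" for j
        using bspec[OF xw that] by simp_all
      \<comment> \<open>any index outside the grid; it labels the point \<open>u\<close>, with weight \<open>- 1\<close>\<close>
      define z :: "'a \<Rightarrow> nat" where "z = (\<lambda>_. Suc L)"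
      obtain b where "b \<in> (Basis :: 'a set)" using nonempty_Basis by blast
      then have z: "z \<notin> ?G" using grid_le[of z L b] by (auto simp: z_def)
      define X where "X = x(z := u)"
      define v where "v = w(z := - 1)"
      have Xv: "X z = u" "v z = - 1" by (simp_all add: X_def v_def)
      have XvG: "X j = x j" "v j = w j" if "j \<in> ?G" for j
        using that z by (auto simp: X_def v_def)
      let ?I = "insert z ?G"
      \<comment> \<open>The reproduced value at \<open>u\<close> minus the value at
        \<open>u\<close>.\<close>
      have ann': "(\<Sum>j\<in>?I. v j * monomial \<alpha> (X j - u)) = 0" if "(\<Sum>b\<in>Basis. \<alpha> b) \<le> L" for \<alpha>
        using ann[THEN spec, THEN mp, OF that] z by (simp add: Xv XvG)
      have dist: "norm (X j - u) \<le> K * h" if "j \<in> ?I" for j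
        using that x(2) K h by (auto simp: Xv XvG)
      have diam: "(norm ((X i - u) - (X j - u)))\<^sup>2 \<le> (2 * K * h)\<^sup>2" if "i \<in> ?I" "j \<in> ?I" for i j
        using norm_triangle_ineq4[of "X i - u" "X j - u"] dist[OF that(1)] dist[OF that(2)]
        by (intro power_mono) auto
      have "predictive_cov (matern \<sigma>sq l \<nu>) D u u
        \<le> (\<Sum>i\<in>?I. \<Sum>j\<in>?I. v i * v j * matern \<sigma>sq l \<nu> (X i) (X j))"
      proof (rule predictive_cov_le_weights[where x = X and v = v, OF matern_commute _ D finite_grid z _ Xv])
        show "(\<Sum>i<length D. \<Sum>j<length D. c i * c j * matern \<sigma>sq l \<nu> (D ! i) (D ! j)) > 0"
          if "i < length D" "c i \<noteq> 0" for c i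
        proof -
          have "(\<Sum>i<length D. \<Sum>j<length D. c i * c j * matern 1 l \<nu> (D ! i) (D ! j)) > 0"
            using D that by (intro matern_strictly_positive_definite[of \<nu> l _ "(!) D" i] pos)
              (auto simp: inj_on_def nth_eq_iff_index_eq)
          then have "\<sigma>sq * (\<Sum>i<length D. \<Sum>j<length D. c i * c j * matern 1 l \<nu> (D ! i) (D ! j)) > 0"
            using \<sigma>(1) by simp
          then show ?thesis
            by (subst matern_scale) (simp add: sum_distrib_left mult_ac)
        qed
      qed (simp add: XvG x(1))
      also have "\<dots> = \<sigma>sq * (\<Sum>i\<in>?I. \<Sum>j\<in>?I. v i * v j * matern 1 l \<nu> (X i - u) (X j - u))"
        unfolding matern_translate sum_distrib_left
        by (subst matern_scale) (intro sum.cong refl, simp)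
      also have "\<dots> \<le> \<sigma>sq * ((\<Sum>i\<in>?I. \<bar>v i\<bar>)\<^sup>2 / Gamma \<nu> *
          (((2 * K * h)\<^sup>2 / (4 * l\<^sup>2)) powr \<nu> * (1 / \<nu> + 3 / (real (Suc L) - \<nu>))))"
        using \<sigma> K h
        by (intro mult_left_mono matern_quadratic_form_small pos ann' diam) auto
      also have "\<dots> \<le> \<sigma>\<^sub>1 * (T\<^sup>2 * M * ((B powr (2 * \<nu>\<^sub>1) * h powr (2 * \<nu>)) * Q))"
      proof (intro mult_mono)
        have "(\<Sum>i\<in>?I. \<bar>v i\<bar>) = 1 + (\<Sum>i\<in>?G. \<bar>w i\<bar>)" using z by (simp add: Xv XvG)
        also have "\<dots> \<le> T" using sum_bounded_above[of ?G "\<lambda>i. \<bar>w i\<bar>" K] w by (simp add: T_def)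
        finally have "(\<Sum>i\<in>?I. \<bar>v i\<bar>)\<^sup>2 \<le> T\<^sup>2" by (intro power_mono sum_nonneg) auto
        then have "(\<Sum>i\<in>?I. \<bar>v i\<bar>)\<^sup>2 * (1 / Gamma \<nu>) \<le> T\<^sup>2 * M"
          using M \<nu> Gamma_real_pos[OF pos(1)] by (intro mult_mono) auto
        then show "(\<Sum>i\<in>?I. \<bar>v i\<bar>)\<^sup>2 / Gamma \<nu> \<le> T\<^sup>2 * M" by simp
        have "(2 * K * h)\<^sup>2 / (4 * l\<^sup>2) = (K / l * h)\<^sup>2"
          by (simp add: power_mult_distrib power_divide)
        also have "\<dots> = (K / l * h) powr 2" using K h pos by (simp add: powr_numeral)
        also have "(\<dots>) powr \<nu> = (K / l) powr (2 * \<nu>) * h powr (2 * \<nu>)"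
          unfolding powr_powr by (rule powr_mult)
        finally have "((2 * K * h)\<^sup>2 / (4 * l\<^sup>2)) powr \<nu> = (K / l) powr (2 * \<nu>) * h powr (2 * \<nu>)" .
        moreover have "(K / l) powr (2 * \<nu>) \<le> B powr (2 * \<nu>)"
        proof (rule powr_mono2)
          have "K / l \<le> K / l\<^sub>0" using K l l0 by (intro divide_left_mono) auto
          then show "K / l \<le> B" by (simp add: B_def)
        qed (use pos K in auto)
        moreover have "B powr (2 * \<nu>) \<le> B powr (2 * \<nu>\<^sub>1)"
          using B \<nu> by (intro powr_mono) auto
        ultimately show "((2 * K * h)\<^sup>2 / (4 * l\<^sup>2)) powr \<nu> \<le> B powr (2 * \<nu>\<^sub>1) * h powr (2 * \<nu>)"
          by (simp add: mult_right_mono)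
        show "1 / \<nu> + 3 / (real (Suc L) - \<nu>) \<le> Q"
          unfolding Q_def using \<nu> \<nu>01 L by (intro add_mono divide_left_mono) auto
      qed (use \<sigma> pos M T Gamma_real_pos[OF pos(1)] in auto)
      also have "\<dots> = C * h powr (2 * \<nu>)" using \<sigma> by (simp add: C_def)
      finally show "predictive_cov (matern \<sigma>sq l \<nu>) D u u \<le> C * h powr (2 * \<nu>)" .
    qed
  qed
qed

section \<open>Fill distance and mesh ratio\<close>

text \<open>Boundedness of \<open>U\<close> makes the supremum an upper bound, and a minimum over
  finitely many points is attained.\<close>

lemma fill_distance_attained:
  fixes U :: "'a::real_normed_vector set"
  assumes "bounded U" "finite P" "P \<noteq> {}" "y \<in> U"
  shows "\<exists>p\<in>P. norm (y - p) \<le> fill_distance U P"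
proof -
  obtain p0 where p0: "p0 \<in> P" using assms by blast
  obtain B where B: "\<And>u. u \<in> U \<Longrightarrow> norm u \<le> B" using assms(1) by (auto simp: bounded_iff)
  have "bdd_above ((\<lambda>u. Min ((\<lambda>p. norm (u - p)) ` P)) ` U)"
  proof (rule bdd_aboveI2)
    fix u assume u: "u \<in> U"
    have "Min ((\<lambda>p. norm (u - p)) ` P) \<le> norm (u - p0)" using assms p0 by (intro Min_le) auto
    also have "\<dots> \<le> B + norm p0" using norm_triangle_ineq4[of u p0] B[OF u] by linarith
    finally show "Min ((\<lambda>p. norm (u - p)) ` P) \<le> B + norm p0" .
  qed
  then have "Min ((\<lambda>p. norm (y - p)) ` P) \<le> fill_distance U P"
    unfolding fill_distance_def using assms(4) by (intro cSUP_upper)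
  moreover have "Min ((\<lambda>p. norm (y - p)) ` P) \<in> (\<lambda>p. norm (y - p)) ` P"
    using assms by (intro Min_in) auto
  ultimately show ?thesis by auto
qed

lemma fill_distance_pos:
  fixes U :: "'a::real_normed_vector set"
  assumes "bounded U" "finite P" "P \<noteq> {}" "infinite U"
  shows "fill_distance U P > 0"
proof -
  obtain y where y: "y \<in> U" "y \<notin> P" using assms(2,4) by (metis finite_subset subsetI)
  obtain p where p: "p \<in> P" "norm (y - p) \<le> fill_distance U P"
    using fill_distance_attained[OF assms(1-3) y(1)] by blast
  then have "0 < norm (y - p)" using y by auto
  then show ?thesis using p by linarith
qed

lemma axis_in_cone_at:
  assumes "norm \<xi> = 1" "0 \<le> t" "t \<le> R"
  shows "x + t *\<^sub>R \<xi> \<in> cone_at x \<xi> \<phi> R"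
proof -
  have "cos \<phi> \<le> inner \<xi> \<xi>" using assms by (simp add: dot_square_norm)
  then show ?thesis unfolding cone_at_def using assms by blast
qed

lemma infinite_if_cone_at_subset:
  assumes "norm \<xi> = 1" "R > 0" "cone_at x \<xi> \<phi> R \<subseteq> U"
  shows "infinite U"
proof -
  have "inj_on (\<lambda>t. x + t *\<^sub>R \<xi>) {0..R}" using assms(1) by (auto simp: inj_on_def)
  then have "infinite ((\<lambda>t. x + t *\<^sub>R \<xi>) ` {0..R})"
    using assms(2) by (simp add: finite_image_iff infinite_Icc)
  moreover have "(\<lambda>t. x + t *\<^sub>R \<xi>) ` {0..R} \<subseteq> U" using axis_in_cone_at[OF assms(1)] assms(3) by auto
  ultimately show ?thesis using finite_subset by blast
qed

text \<open>If the fill distance were below the separation radius \<open>q\<close>, one could walk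
  from a design point along its cone axis by a length \<open>t\<close> strictly between the two. The
  design point near the end of the walk is a different one, yet closer than \<open>2 * q\<close> to
  the start. The bound by \<open>R\<close> keeps the walk inside \<open>U\<close>.\<close>

lemma one_le_mesh_ratio:
  fixes U :: "'a::euclidean_space set"
  assumes U: "bounded U" and P: "finite P" "P \<subseteq> U" "card P \<ge> 2"
    and cone: "\<And>x. x \<in> U \<Longrightarrow> \<exists>\<xi>. norm \<xi> = 1 \<and> cone_at x \<xi> \<phi> R \<subseteq> U"
    and h: "fill_distance U P < R"
  shows "1 \<le> mesh_ratio U P"
proof -
  let ?S = "{norm (p - q) | p q. p \<in> P \<and> q \<in> P \<and> p \<noteq> q}"
  define q where "q = separation_radius P"
  have "?S \<subseteq> (\<lambda>(p, q). norm (p - q)) ` (P \<times> P)" by auto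
  then have fin: "finite ?S" using P(1) by (meson finite_SigmaI finite_imageI finite_subset)
  obtain p1 where p1: "p1 \<in> P" using P(3) by fastforce
  have "P - {p1} \<noteq> {}" using P(1,3) p1 by (metis One_nat_def Suc_1 card.empty card_Diff_singleton diff_is_0_eq not_less_eq_eq order_refl)
  then have ne: "?S \<noteq> {}" using p1 by blast
  have q2: "2 * q \<le> norm (a - b)" if "a \<in> P" "b \<in> P" "a \<noteq> b" for a b
    unfolding q_def separation_radius_def using Min_le[OF fin, of "norm (a - b)"] that by auto
  have q: "q > 0"
    unfolding q_def separation_radius_def using Min_in[OF fin ne] by auto
  have "q \<le> fill_distance U P"
  proof (rule ccontr)
    assume "\<not> ?thesis"
    then have "fill_distance U P < min q R" using h by simp
    then obtain t where t: "fill_distance U P < t" "t < min q R" using dense by blast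
    obtain \<xi> where \<xi>: "norm \<xi> = 1" "cone_at p1 \<xi> \<phi> R \<subseteq> U" using cone p1 P(2) by blast
    have h0: "0 \<le> fill_distance U P"
      using fill_distance_attained[OF U P(1) _ , of p1] p1 P(2) by (metis empty_iff norm_ge_zero order_trans subsetD)
    have "p1 + t *\<^sub>R \<xi> \<in> U" using axis_in_cone_at[OF \<xi>(1), of t R p1 \<phi>] \<xi>(2) t h0 by auto
    from fill_distance_attained[OF U P(1) _ this] p1
    obtain p where p: "p \<in> P" "norm (p1 + t *\<^sub>R \<xi> - p) \<le> fill_distance U P" by blast
    have nt: "norm (t *\<^sub>R \<xi>) = t" using \<xi>(1) t h0 by simp
    have "p \<noteq> p1" using p(2) nt t by auto
    then have "2 * q \<le> norm (p1 - p)" using q2 p1 p(1) by blast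
    also have "\<dots> \<le> norm (p1 + t *\<^sub>R \<xi> - p) + norm (t *\<^sub>R \<xi>)"
      using norm_triangle_ineq4[of "p1 + t *\<^sub>R \<xi> - p" "t *\<^sub>R \<xi>"] by simp
    finally show False using p(2) nt t by linarith
  qed
  then show ?thesis using q by (simp add: mesh_ratio_def q_def)
qed

section \<open>Integration over the domain and the final estimate\<close>

lemma predictive_sd_L2_le:
  assumes U: "compact U" and B: "B \<ge> 0" "\<And>u. u \<in> U \<Longrightarrow> predictive_cov k D u u \<le> B"
  shows "predictive_sd_L2 U k D \<le> sqrt (B * measure lebesgue U)"
proof -
  have Ul: "U \<in> lmeasurable" using U by (rule lmeasurable_compact)
  then have Us: "U \<in> sets lebesgue" by (rule fmeasurableD)
  have m: "measure (lebesgue_on U) (space (lebesgue_on U)) = measure lebesgue U"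
    using Us by (simp add: measure_restrict_space space_restrict_space)
  have "(\<integral>u. predictive_cov k D u u \<partial>(lebesgue_on U)) \<le> B * measure lebesgue U"
  proof (cases "integrable (lebesgue_on U) (\<lambda>u. predictive_cov k D u u)")
    case True
    have "(\<integral>u. predictive_cov k D u u \<partial>(lebesgue_on U)) \<le> (\<integral>u. B \<partial>(lebesgue_on U))"
      using B True finite_measure.integrable_const[OF finite_measure_lebesgue_on[OF Ul]]
      by (intro integral_mono) (auto simp: space_restrict_space)
    then show ?thesis using m by (simp add: mult.commute)
  next
    \<comment> \<open>The integral then has the default value \<open>0\<close>, and
      \<open>B \<ge> 0\<close> gives the bound.\<close>
    case False
    then show ?thesis using B by (simp add: not_integrable_integral_eq)
  qed
  then show ?thesis unfolding predictive_sd_L2_def by simp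
qed

theorem theorem3p8:
  fixes U :: "(real^'d) set"
    and f :: "real^'d \<Rightarrow> real"
    and m :: "real^'m \<Rightarrow> real^'d \<Rightarrow> real"
    and R S :: "'m hyper set"
    and \<theta>hat :: "nat \<Rightarrow> 'm hyper"
    and D :: "nat \<Rightarrow> (real^'d) list"
    and H :: "'m hyper \<Rightarrow> (real^'d \<Rightarrow> real) set"
    and ip :: "'m hyper \<Rightarrow> (real^'d \<Rightarrow> real) \<Rightarrow> (real^'d \<Rightarrow> real) \<Rightarrow> real"
    and \<tau>t r \<tau>minus \<tau>plus r' :: real
    and n n' Nstar :: nat
  assumes R_pos: "R \<subseteq> UNIV \<times> {0<..} \<times> {0<..} \<times> {0<..}"
    and S: "compact S" "S \<subseteq> R"
    and estimates: "\<And>N. N \<ge> 1 \<Longrightarrow> \<theta>hat N \<in> S"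
    and design: "\<And>N. N \<ge> 1 \<Longrightarrow> length (D N) = N \<and> distinct (D N) \<and> set (D N) \<subseteq> U"
    and a: "compact U" "lipschitz_boundary U" "interior_cone_condition U"
    and native_space: "\<And>\<theta>. \<theta> \<in> S \<Longrightarrow> rkhs U (matern_kernel \<theta>) (H \<theta>) (ip \<theta>)"
    and b: "\<And>\<theta>. \<theta> \<in> S \<Longrightarrow>
              isomorphic_to_sobolev (H \<theta>) (ip \<theta>) (interior U) (matern_order TYPE('d) \<theta>)"
    and c: "f \<in> sobolev_space (interior U) \<tau>t"
           "\<tau>t = real n + r" "real n > real CARD('d) / 2" "0 \<le> r" "r < 1"
    and d: "\<And>\<theta>. \<theta> \<in> S \<Longrightarrow> m (fst \<theta>) \<in> sobolev_space (interior U) \<tau>t"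
    and e: "Nstar \<ge> 1"
           "\<tau>minus = (INF N\<in>{Nstar..}. matern_order TYPE('d) (\<theta>hat N))"
           "\<tau>plus = (SUP N\<in>{Nstar..}. matern_order TYPE('d) (\<theta>hat N))"
           "\<tau>minus = real n' + r'" "real n' > real CARD('d) / 2" "0 \<le> r'" "r' < 1"
  shows "\<exists>C h\<^sub>0. h\<^sub>0 > 0 \<and>
           (\<forall>N \<epsilon>. N \<ge> Nstar \<and> fill_distance U (set (D N)) \<le> h\<^sub>0 \<and> \<epsilon> > 0 \<longrightarrow>
              predictive_sd_L2 U (matern_kernel (\<theta>hat N)) (D N)
                \<le> C * fill_distance U (set (D N)) powr (min \<tau>t \<tau>minus - real CARD('d) / 2 - \<epsilon>)
                    * mesh_ratio U (set (D N)) powr (max (\<tau>plus - \<tau>t) 0))"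
proof -
  let ?d = "real CARD('d)"
  define sq where "sq \<theta> = fst (snd \<theta>)" for \<theta> :: "'m hyper"
  define ls where "ls \<theta> = fst (snd (snd \<theta>))" for \<theta> :: "'m hyper"
  define nu where "nu \<theta> = snd (snd (snd \<theta>))" for \<theta> :: "'m hyper"
  have kernel: "matern_kernel \<theta> = (matern (sq \<theta>) (ls \<theta>) (nu \<theta>) :: real^'d \<Rightarrow> real^'d \<Rightarrow> real)" for \<theta> :: "'m hyper"
    by (simp add: matern_kernel_def sq_def ls_def nu_def split_beta)
  have order: "matern_order TYPE('d) \<theta> = nu \<theta> + ?d / 2" for \<theta> :: "'m hyper"
    by (simp add: matern_order_def nu_def split_beta)
  have S_pos: "0 < sq \<theta>" "0 < ls \<theta>" "0 < nu \<theta>" if "\<theta> \<in> S" for \<theta>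
    using that S(2) R_pos by (auto simp: sq_def ls_def nu_def)
  have S_ne: "S \<noteq> {}" using estimates[of 1] by auto
  have cont: "continuous_on S sq" "continuous_on S ls" "continuous_on S nu"
    unfolding sq_def[abs_def] ls_def[abs_def] nu_def[abs_def] by (intro continuous_intros)+
  \<comment> \<open>Compactness of \<open>S\<close> and positivity of the parameters give the
    uniform bounds that \<open>matern_predictive_cov_le\<close> asks for.\<close>
  obtain \<theta>1 where "\<forall>\<theta>\<in>S. sq \<theta> \<le> sq \<theta>1"
    using continuous_attains_sup[OF S(1) S_ne cont(1)] by blast
  then obtain \<sigma>1 where \<sigma>1: "\<forall>\<theta>\<in>S. sq \<theta> \<le> \<sigma>1" by blast
  obtain \<theta>2 where "\<theta>2 \<in> S" "\<forall>\<theta>\<in>S. ls \<theta>2 \<le> ls \<theta>"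
    using continuous_attains_inf[OF S(1) S_ne cont(2)] by blast
  then obtain l0 where l0: "0 < l0" "\<forall>\<theta>\<in>S. l0 \<le> ls \<theta>" using S_pos by blast
  obtain \<theta>3 where "\<theta>3 \<in> S" "\<forall>\<theta>\<in>S. nu \<theta>3 \<le> nu \<theta>"
    using continuous_attains_inf[OF S(1) S_ne cont(3)] by blast
  then obtain \<nu>0 where \<nu>0: "0 < \<nu>0" "\<forall>\<theta>\<in>S. \<nu>0 \<le> nu \<theta>" using S_pos by blast
  obtain \<theta>4 where "\<forall>\<theta>\<in>S. nu \<theta> \<le> nu \<theta>4"
    using continuous_attains_sup[OF S(1) S_ne cont(3)] by blast
  then obtain \<nu>1 where \<nu>1: "\<forall>\<theta>\<in>S. nu \<theta> \<le> \<nu>1" by blast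
  obtain C h1 where C: "C \<ge> 0" and h1: "h1 > 0" and
    cov: "\<forall>\<sigma>sq l \<nu> D h u. 0 < \<sigma>sq \<and> \<sigma>sq \<le> \<sigma>1 \<and> l0 \<le> l \<and> \<nu>0 \<le> \<nu> \<and> \<nu> \<le> \<nu>1 \<and> distinct D \<and>
       (\<forall>y\<in>U. \<exists>p\<in>set D. norm (y - p) \<le> h) \<and> 0 < h \<and> h \<le> h1 \<and> u \<in> U \<longrightarrow>
       predictive_cov (matern \<sigma>sq l \<nu>) D u u \<le> C * h powr (2 * \<nu>)"
    by (rule matern_predictive_cov_le[OF a(3) \<nu>0(1) l0(1), of \<sigma>1 \<nu>1]) (rule that)
  obtain \<phi> r0 where r0: "r0 > 0" and
    cone: "\<And>x. x \<in> U \<Longrightarrow> \<exists>\<xi>. norm \<xi> = 1 \<and> cone_at x \<xi> \<phi> r0 \<subseteq> U"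
    using a(3) unfolding interior_cone_condition_def by blast
  have bU: "bounded U" using a(1) by (rule compact_imp_bounded)
  define h where "h N = fill_distance U (set (D N))" for N
  have D: "distinct (D N)" "set (D N) \<subseteq> U" "card (set (D N)) = N" "set (D N) \<noteq> {}" if "N \<ge> 1" for N
    using design[OF that] that by (auto simp: distinct_card)
  \<comment> \<open>A cone at one point makes \<open>U\<close> infinite, so no finite design has
    fill distance zero.\<close>
  have "U \<noteq> {}" using D(2,4)[of 1] by auto
  then obtain x \<xi> where "norm \<xi> = 1" "cone_at x \<xi> \<phi> r0 \<subseteq> U" using cone by blast
  then have "infinite U" using r0 by (intro infinite_if_cone_at_subset)
  then have h_pos: "h N > 0" if "N \<ge> 1" for N
    unfolding h_def using D[OF that] bU by (intro fill_distance_pos) auto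
  \<comment> \<open>The bound \<open>1\<close> allows exponents to be lowered, \<open>h1\<close>
    admits the variance estimate and \<open>r0 / 2\<close> admits the mesh ratio estimate.\<close>
  define h0 where "h0 = min (min 1 h1) (min (r0 / 2) (h 1 / 2))"
  have h0: "h0 > 0" "h0 \<le> 1" "h0 \<le> h1" "h0 < r0" "h0 < h 1"
    using h1 r0 h_pos[of 1] by (auto simp: h0_def min_def)
  define M where "M = sqrt (C * measure lebesgue U)"
  have M: "M \<ge> 0" using C by (simp add: M_def)
  \<comment> \<open>\<open>h0 < h 1\<close> excludes the case \<open>N = 1\<close>, where the mesh ratio is a junk value\<close>
  have bound: "predictive_sd_L2 U (matern_kernel (\<theta>hat N)) (D N)
      \<le> M * h N powr (min \<tau>t \<tau>minus - ?d / 2 - \<epsilon>) * mesh_ratio U (set (D N)) powr (max (\<tau>plus - \<tau>t) 0)"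
    if N: "N \<ge> Nstar" "h N \<le> h0" and \<epsilon>: "\<epsilon> > 0" for N \<epsilon>
  proof -
    have N1: "N \<ge> 1" using N(1) e(1) by simp
    have "N \<noteq> 1" using N(2) h0(5) by auto
    then have N2: "N \<ge> 2" using N1 by simp
    have \<theta>: "\<theta>hat N \<in> S" by (rule estimates[OF N1])
    define \<nu> where "\<nu> = nu (\<theta>hat N)"
    have near: "\<forall>y\<in>U. \<exists>p\<in>set (D N). norm (y - p) \<le> h N"
      unfolding h_def using fill_distance_attained[OF bU _ D(4)[OF N1]] by simp
    have "predictive_cov (matern_kernel (\<theta>hat N)) (D N) u u \<le> C * h N powr (2 * \<nu>)" if u: "u \<in> U" for u
      unfolding kernel \<nu>_def
      by (rule cov[THEN spec, THEN spec, THEN spec, THEN spec, THEN spec, THEN spec, THEN mp])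
         (intro conjI S_pos bspec[OF \<sigma>1] bspec[OF l0(2)] bspec[OF \<nu>0(2)] bspec[OF \<nu>1] \<theta> D(1)[OF N1] near
            h_pos[OF N1] order_trans[OF N(2) h0(3)] u)
    then have "predictive_sd_L2 U (matern_kernel (\<theta>hat N)) (D N)
        \<le> sqrt (C * h N powr (2 * \<nu>) * measure lebesgue U)"
      using C by (intro predictive_sd_L2_le a(1)) auto
    also have "\<dots> = M * sqrt (h N powr (2 * \<nu>))"
      by (simp add: M_def real_sqrt_mult mult_ac)
    also have "sqrt (h N powr (2 * \<nu>)) = h N powr \<nu>"
      using h_pos[OF N1] by (simp add: powr_half_sqrt[symmetric] powr_powr)
    \<comment> \<open>For \<open>0 < h N \<le> 1\<close> a smaller exponent gives a larger power,
      and \<nu> is the order at \<open>\<theta>hat N\<close> minus half the dimension, hence at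
      least \<open>\<tau>minus - ?d / 2\<close>.\<close>
    also have "M * h N powr \<nu> \<le> M * h N powr (min \<tau>t \<tau>minus - ?d / 2 - \<epsilon>)"
    proof (intro mult_left_mono powr_mono' M)
      have "bdd_below ((\<lambda>N. matern_order TYPE('d) (\<theta>hat N)) ` {Nstar..})"
      proof (rule bdd_belowI2[of _ 0])
        fix N assume "N \<in> {Nstar..}"
        then have "N \<ge> 1" using e(1) by simp
        then show "0 \<le> matern_order TYPE('d) (\<theta>hat N)"
          using S_pos(3)[OF estimates[of N]] by (simp add: order)
      qed
      then have "\<tau>minus \<le> matern_order TYPE('d) (\<theta>hat N)"
        unfolding e(2) using N(1) by (intro cINF_lower) auto
      then show "min \<tau>t \<tau>minus - ?d / 2 - \<epsilon> \<le> \<nu>"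
        using \<epsilon> by (simp add: order \<nu>_def)
    qed (use h_pos[OF N1] N(2) h0(2) in auto)
    \<comment> \<open>The mesh ratio is at least \<open>1\<close> and its exponent is nonnegative,
      so the factor can be inserted.\<close>
    also have "\<dots> \<le> M * h N powr (min \<tau>t \<tau>minus - ?d / 2 - \<epsilon>) * mesh_ratio U (set (D N)) powr (max (\<tau>plus - \<tau>t) 0)"
    proof -
      have "1 \<le> mesh_ratio U (set (D N))"
        using D[OF N1] N2 N(2) h0(4) cone by (intro one_le_mesh_ratio[OF bU]) (auto simp: h_def)
      then have ge: "1 \<le> mesh_ratio U (set (D N)) powr (max (\<tau>plus - \<tau>t) 0)"
        by (intro ge_one_powr_ge_zero) auto
      then show ?thesis using mult_left_mono[OF ge, of "M * h N powr (min \<tau>t \<tau>minus - ?d / 2 - \<epsilon>)"] M by simp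
    qed
    finally show ?thesis .
  qed
  show ?thesis
    by (intro exI[of _ M] exI[of _ h0] conjI allI impI h0(1), fold h_def, elim conjE, rule bound)
qed

end
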